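(* Let $X$ and $Y$ be random vectors in $\mathbb{R}^d$ whose distributions $\mathsf{P}_X$ and $\mathsf{P}_Y$ have densities $p$ and $q$, respectively, with respect to Lebesgue measure. Suppose that for some $\varepsilon_i>0$, $R_i>0$ ($i=1,2,3,4$) and some $N_1,N_2\in\mathbb{N}$ the functionals $K_{p,q}(1,N_1)$, $Q_{p,q}(\varepsilon_1,R_1)$, $T_{p,q}(\varepsilon_2,R_2)$, $K_{p,p}(1,N_2)$, $Q_{p,p}(\varepsilon_3,R_3)$, $T_{p,p}(\varepsilon_4,R_4)$ are finite. Then, for any fixed $k,l\in\mathbb{N}$, the estimates $\widehat{D}_{n,m}(k,l)$ are asymptotically unbiased, i.e. $$\lim_{n,m\to\infty}\mathsf{E}\,\widehat{D}_{n,m}(k,l)=D(\mathsf{P}_X\|\mathsf{P}_Y).$$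
   Context: Kullback-Leibler divergence: for probability measures with Lebesgue densities $p,q$ on $\mathbb{R}^d$, $D(\mathsf{P}_X\|\mathsf{P}_Y)=\int_{\mathbb{R}^d}p(x)\log\frac{p(x)}{q(x)}\,dx$ if $\mathsf{P}_X\ll\mathsf{P}_Y$, and $D(\mathsf{P}_X\|\mathsf{P}_Y)=+\infty$ otherwise (natural logarithm; $0/0:=0$, $0\cdot\log 0:=0$). Estimator: $X_1,X_2,\ldots$ are i.i.d. with the law of $X$, $Y_1,Y_2,\ldots$ are i.i.d. with the law of $Y$, and all the vectors $X_i,Y_i$, $i\in\mathbb{N}$, are independent. $\|\cdot\|$ is the Euclidean norm. $\mathbb{X}_n=\{X_1,\ldots,X_n\}$, $\mathbb{Y}_m=\{Y_1,\ldots,Y_m\}$ (almost surely all points are distinct). For a finite set $E$ and a point $v$, $z_{(k)}(v,E)$ denotes the $k$-th nearest neighbor of $v$ in $E$ (ties broken by increasing index). For $n\ge k+1$, $m\ge l$, $i=1,\ldots,n$ let $R_{n,k}(i)=\|X_i-X_{(k)}(X_i,\mathbb{X}_n\setminus\{X_i\})\|$ (distance from $X_i$ to its $k$-th nearest neighbor among the other $X_j$) and $V_{m,l}(i)=\|X_i-Y_{(l)}(X_i,\mathbb{Y}_m)\|$ (distance from $X_i$ to its $l$-th nearest neighbor in $\mathbb{Y}_m$). Put $$\widehat{D}_{n,m}(k,l)=\psi(k)-\psi(l)+\frac1n\sum_{i=1}^n\log\left(\frac{m\,V_{m,l}^d(i)}{(n-1)\,R_{n,k}^d(i)}\right),$$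 where $\psi(t)=\Gamma'(t)/\Gamma(t)$ is the digamma function. Functionals: let $e_{[0]}=1$, $e_{[N]}=\exp\{e_{[N-1]}\}$, $\log_{[1]}(t)=\log t$, $\log_{[N]}(t)=\log(\log_{[N-1]}(t))$ for $N>1$ and $t>e_{[N-2]}$. Let $G_N:\mathbb{R}_+\to\mathbb{R}_+$, $G_N(t)=0$ for $t\in[0,e_{[N-1]}]$ and $G_N(t)=t\log_{[N]}(t)$ for $t>e_{[N-1]}$. Let $B(x,r)=\{y:\|x-y\|\le r\}$ and let $V_d$ be the volume of the unit ball in $\mathbb{R}^d$. For a probability density $f$ on $\mathbb{R}^d$, $x\in\mathbb{R}^d$, $r,R>0$, set $I_f(x,r)=\frac{1}{r^dV_d}\int_{B(x,r)}f(y)\,dy$, $M_f(x,R)=\sup_{r\in(0,R]}I_f(x,r)$, $m_f(x,R)=\inf_{r\in(0,R]}I_f(x,r)$. For probability densities $p,q$ (possibly $q=p$), $\nu,\varepsilon,R>0$ and $N\in\mathbb{N}$ define, with values in $[0,\infty]$, $$K_{p,q}(\nu,N)=\iint_{\|x-y\|>e_{[N]}}G_N\big(|\log\|x-y\||^{\nu}\big)p(x)q(y)\,dx\,dy,$$ $$Q_{p,q}(\varepsilon,R)=\int_{\mathbb{R}^d}M_q(x,R)^{\varepsilon}p(x)\,dx,\qquad T_{p,q}(\varepsilon,R)=\int_{\mathbb{R}^d}m_q(x,R)^{-\varepsilon}p(x)\,dx,$$ where $1/0:=\infty$; the integrals defining $Q_{p,q}$ and $T_{p,q}$ may equivalently be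 taken over $\{x:p(x)>0\}$. *)

theory Defs
  imports "HOL-Probability.Probability"
begin

text \<open>Densities are nonnegative real functions on a Euclidean space \<open>'a\<close>, which stands for
  \<open>R^d\<close> with \<open>d = DIM('a)\<close>.\<close>

subsection \<open>Kullback--Leibler divergence\<close>

text \<open>The library's \<open>KL_divergence\<close> is real-valued. Here \<open>+\<infinity>\<close> must be a possible value, so the
  integral is the difference of the integrals of the positive and the negative part of the integrand
  (for probability densities the latter is finite, because \<open>u * ln u \<ge> - exp (-1)\<close>).
  The conventions \<open>0 / 0 = 0\<close> and \<open>0 * ln 0 = 0\<close> hold in HOL; points with \<open>p x > 0\<close> and
  \<open>q x = 0\<close> form a null set in the first branch.\<close>

definition KL_density :: "('a::euclidean_space \<Rightarrow> real) \<Rightarrow> ('a \<Rightarrow> real) \<Rightarrow> ereal" where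
  "KL_density p q =
     (if absolutely_continuous (density lborel (\<lambda>x. ennreal (q x))) (density lborel (\<lambda>x. ennreal (p x)))
      then enn2ereal (\<integral>\<^sup>+x. ennreal (p x * ln (p x / q x)) \<partial>lborel)
           - enn2ereal (\<integral>\<^sup>+x. ennreal (- (p x * ln (p x / q x))) \<partial>lborel)
      else \<infinity>)"

subsection \<open>The nearest neighbor estimator\<close>

text \<open>The \<open>k\<close>-th nearest neighbor of \<open>v\<close> (\<open>k \<ge> 1\<close>) among the points \<open>z i\<close>, \<open>i \<in> I\<close>. Since
  \<open>sort_key\<close> is stable, ties are broken by increasing index.\<close>

definition nearest_neighbor :: "nat \<Rightarrow> 'a::real_normed_vector \<Rightarrow> (nat \<Rightarrow> 'a) \<Rightarrow> nat set \<Rightarrow> 'a" where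
  "nearest_neighbor k v z I =
     z (sort_key (\<lambda>i. norm (v - z i)) (sorted_list_of_set I) ! (k - 1))"

definition R_dist :: "nat \<Rightarrow> nat \<Rightarrow> (nat \<Rightarrow> 'a::real_normed_vector) \<Rightarrow> nat \<Rightarrow> real" where
  "R_dist n k x i = norm (x i - nearest_neighbor k (x i) x ({1..n} - {i}))"

definition V_dist :: "nat \<Rightarrow> nat \<Rightarrow> (nat \<Rightarrow> 'a::real_normed_vector) \<Rightarrow> (nat \<Rightarrow> 'a) \<Rightarrow> nat \<Rightarrow> real" where
  "V_dist m l x y i = norm (x i - nearest_neighbor l (x i) y {1..m})"

text \<open>The estimate as a function of the samples \<open>x 1, x 2, \<dots>\<close> and \<open>y 1, y 2, \<dots>\<close>; it is meaningful
  for \<open>n \<ge> k + 1\<close> and \<open>m \<ge> l\<close>.\<close>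

definition KL_estimate ::
  "nat \<Rightarrow> nat \<Rightarrow> nat \<Rightarrow> nat \<Rightarrow> (nat \<Rightarrow> 'a::euclidean_space) \<Rightarrow> (nat \<Rightarrow> 'a) \<Rightarrow> real" where
  "KL_estimate n m k l x y =
     Digamma (real k) - Digamma (real l)
     + (1 / real n) * (\<Sum>i=1..n. ln ((real m * V_dist m l x y i ^ DIM('a))
                                     / ((real n - 1) * R_dist n k x i ^ DIM('a))))"

subsection \<open>The functionals\<close>

primrec exp_iter :: "nat \<Rightarrow> real" where
  "exp_iter 0 = 1"
| "exp_iter (Suc N) = exp (exp_iter N)"

primrec log_iter :: "nat \<Rightarrow> real \<Rightarrow> real" where
  "log_iter 0 t = t"
| "log_iter (Suc N) t = ln (log_iter N t)"

text \<open>Used only for \<open>N \<ge> 1\<close> and \<open>t \<ge> 0\<close>.\<close>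

definition G_fun :: "nat \<Rightarrow> real \<Rightarrow> real" where
  "G_fun N t = (if t \<le> exp_iter (N - 1) then 0 else t * log_iter N t)"

definition K_fun :: "('a::euclidean_space \<Rightarrow> real) \<Rightarrow> ('a \<Rightarrow> real) \<Rightarrow> real \<Rightarrow> nat \<Rightarrow> ennreal" where
  "K_fun p q \<nu> N =
     (\<integral>\<^sup>+(x, y)\<in>{(x, y). norm (x - y) > exp_iter N}.
        ennreal (G_fun N (\<bar>ln (norm (x - y))\<bar> powr \<nu>) * p x * q y) \<partial>(lborel \<Otimes>\<^sub>M lborel))"

definition ball_average :: "('a::euclidean_space \<Rightarrow> real) \<Rightarrow> 'a \<Rightarrow> real \<Rightarrow> ennreal" where
  "ball_average f x r =
     (\<integral>\<^sup>+y\<in>cball x r. ennreal (f y) \<partial>lborel)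
     / ennreal (r ^ DIM('a) * measure lborel (cball (0::'a) 1))"

definition M_fun :: "('a::euclidean_space \<Rightarrow> real) \<Rightarrow> 'a \<Rightarrow> real \<Rightarrow> ennreal" where
  "M_fun f x R = (SUP r\<in>{0<..R}. ball_average f x r)"

definition m_fun :: "('a::euclidean_space \<Rightarrow> real) \<Rightarrow> 'a \<Rightarrow> real \<Rightarrow> ennreal" where
  "m_fun f x R = (INF r\<in>{0<..R}. ball_average f x r)"

text \<open>Power with a real exponent \<open>a > 0\<close> on \<open>[0, \<infinity>]\<close>, with \<open>\<infinity>\<close> raised to \<open>a\<close> being \<open>\<infinity>\<close>.\<close>

definition ennreal_rpow :: "ennreal \<Rightarrow> real \<Rightarrow> ennreal" where
  "ennreal_rpow u a = (if u = \<infinity> then \<infinity> else ennreal (enn2real u powr a))"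

text \<open>In \<open>ennreal\<close>, \<open>\<infinity> * 0 = 0\<close> and \<open>inverse 0 = \<infinity>\<close>, so the points with \<open>p x = 0\<close> do not
  contribute to the following two integrals.\<close>

definition Q_fun :: "('a::euclidean_space \<Rightarrow> real) \<Rightarrow> ('a \<Rightarrow> real) \<Rightarrow> real \<Rightarrow> real \<Rightarrow> ennreal" where
  "Q_fun p q \<epsilon> R = (\<integral>\<^sup>+x. ennreal_rpow (M_fun q x R) \<epsilon> * ennreal (p x) \<partial>lborel)"

definition T_fun :: "('a::euclidean_space \<Rightarrow> real) \<Rightarrow> ('a \<Rightarrow> real) \<Rightarrow> real \<Rightarrow> real \<Rightarrow> ennreal" where
  "T_fun p q \<epsilon> R = (\<integral>\<^sup>+x. inverse (ennreal_rpow (m_fun q x R) \<epsilon>) * ennreal (p x) \<partial>lborel)"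

end

theory Submission
  imports Defs
begin

text \<open>
  Write \<open>F x r\<close> for the \<open>q\<close>-mass of the ball \<open>cball x r\<close>, \<open>\<rho>\<close> for the distance from \<open>X\<close> to its \<open>l\<close>-th nearest
  neighbor in the sample \<open>Y\<^sub>1, \<dots>, Y\<^sub>m\<close>, and \<open>I x r\<close> for the ratio of \<open>F x r\<close> and the volume \<open>V\<^sub>d r\<^sup>d\<close>. Then
  \<open>ln (m V\<^sub>d \<rho>\<^sup>d) = ln m + ln (F X \<rho>) - ln (I X \<rho>)\<close>.
  Given \<open>X\<close>, the number \<open>F X \<rho>\<close> is the \<open>l\<close>-th order statistic of \<open>m\<close> independent uniform variables, so the
  mean of its logarithm is exactly \<open>- (1/l + \<dots> + 1/m)\<close>, and adding \<open>ln m\<close> gives the digamma value in the limit.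
  By the Lebesgue differentiation theorem \<open>ln (I X \<rho>)\<close> converges to \<open>ln (q X)\<close> almost surely, and it is dominated:
  for small \<open>\<rho>\<close> by the logarithms of the maximal and minimal functions (the functionals \<open>Q\<close> and \<open>T\<close>), for
  large \<open>\<rho>\<close> by the sum of the positive parts of \<open>ln (norm (X - Y\<^sub>j))\<close> over the first \<open>l\<close> sample points (the functional \<open>K\<close>).
  The same statement with \<open>q = p\<close> treats the distances within the first sample; the
  volume constants cancel in the difference.
\<close>

subsection \<open>Nearest neighbor distances\<close>

text \<open>Only one of the two factors needs a limit argument. The mean for
  \<open>F X \<rho>\<close> is exact because spheres are null under \<open>q\<close>, so the law of
  the distance to a fixed point has no atoms. For \<open>I X \<rho>\<close>, one infinite sample
  serves all \<open>m\<close> at once, which gives almost sure convergence in \<open>m\<close> a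
  meaning; and the \<open>l\<close>-th distance among \<open>m \<ge> l\<close> points never exceeds
  the largest of the first \<open>l\<close> distances, so a majorant free of \<open>m\<close>
  exists. The powers in \<open>Q\<close> and \<open>T\<close> become logarithms through
  \<open>\<epsilon> ln t \<le> t powr \<epsilon>\<close>, and \<open>K\<close> bounds the mean of
  the logarithmic distance through \<open>t \<le> G_fun N t\<close> for large \<open>t\<close>.
  Beyond a fixed radius \<open>R\<close> the mass lies between \<open>F x R\<close> and 1, so only
  \<open>d ln \<rho>\<close> remains to be controlled there. The summands of the estimator are
  dependent but have a common mean. By linearity the expectation is, up to a constant, a function of
  \<open>m\<close> minus a function of \<open>n - 1\<close>, and the double limit splits into two
  single ones. The majorant also makes \<open>ln q\<close> and \<open>ln p\<close> integrable under
  \<open>p\<close>, so the divergence is finite.\<close>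

definition nn_dist :: "nat \<Rightarrow> 'a::real_normed_vector \<Rightarrow> (nat \<Rightarrow> 'a) \<Rightarrow> nat set \<Rightarrow> real" where
  "nn_dist k v z I = norm (v - nearest_neighbor k v z I)"

text \<open>The entries \<open>\<le> r\<close> of a sorted list form a prefix; position
  \<open>k - 1\<close> belongs to it exactly when the prefix has length at least
  \<open>k\<close>.\<close>

lemma sorted_nth_le_iff:
  fixes ys :: "'b::linorder list"
  assumes "sorted ys" "1 \<le> k" "k \<le> length ys"
  shows "ys ! (k - 1) \<le> r \<longleftrightarrow> k \<le> length (filter (\<lambda>y. y \<le> r) ys)"
  using assms
proof (induction ys arbitrary: k)
  case (Cons y ys)
  show ?case
  proof (cases "k = 1")
    case True
    have "filter (\<lambda>y. y \<le> r) ys = []" if "\<not> y \<le> r"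
      using Cons.prems(1) that by (auto simp: filter_empty_conv)
    then show ?thesis using True by auto
  next
    case False
    then obtain j where j: "k = Suc j" "1 \<le> j" using Cons.prems(2) by (cases k) auto
    have IH: "ys ! (j - 1) \<le> r \<longleftrightarrow> j \<le> length (filter (\<lambda>y. y \<le> r) ys)"
      using Cons j by auto
    have "y \<le> r" if "ys ! (j - 1) \<le> r"
    proof -
      have "ys ! (j - 1) \<in> set ys" using Cons.prems j by (intro nth_mem) auto
      then show ?thesis using Cons.prems(1) that by auto
    qed
    moreover have "filter (\<lambda>y. y \<le> r) ys = []" if "\<not> y \<le> r"
      using Cons.prems(1) that by (auto simp: filter_empty_conv)
    ultimately show ?thesis using IH j by (auto simp: nth_Cons')
  qed
qed auto

text \<open>Replaces sorting by counting. Reindexing, measurability and the law of the distance all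
  go through this criterion.\<close>

lemma nn_dist_le_iff:
  assumes "finite I" "1 \<le> k" "k \<le> card I"
  shows "nn_dist k v z I \<le> r \<longleftrightarrow> k \<le> card {i\<in>I. norm (v - z i) \<le> r}"
proof -
  define f where "f = (\<lambda>i. norm (v - z i))"
  define xs where "xs = sort_key f (sorted_list_of_set I)"
  have xs: "distinct xs" "set xs = I" "sorted (map f xs)" "length xs = card I"
    using assms by (auto simp: xs_def)
  have "nn_dist k v z I = map f xs ! (k - 1)"
    using assms xs by (simp add: nn_dist_def nearest_neighbor_def f_def xs_def)
  also have "\<dots> \<le> r \<longleftrightarrow> k \<le> length (filter (\<lambda>y. y \<le> r) (map f xs))"
    using assms xs by (intro sorted_nth_le_iff) auto
  also have "length (filter (\<lambda>y. y \<le> r) (map f xs)) = card (set (filter (\<lambda>i. f i \<le> r) xs))"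
    using xs by (subst distinct_card) (auto simp: filter_map o_def)
  also have "set (filter (\<lambda>i. f i \<le> r) xs) = {i\<in>I. norm (v - z i) \<le> r}"
    using xs by (auto simp: f_def)
  finally show ?thesis .
qed

text \<open>Another index order may break ties differently and select another neighbor, but the
  counts in the criterion, hence the distance, stay the same.\<close>

lemma nn_dist_reindex:
  assumes h: "bij_betw h J I" and "finite J" "1 \<le> k" "k \<le> card J"
  shows "nn_dist k v z I = nn_dist k v (\<lambda>j. z (h j)) J"
proof (rule antisym)
  have I: "finite I" "k \<le> card I"
    using assms bij_betw_finite bij_betw_same_card by metis+
  have "card {i\<in>I. norm (v - z i) \<le> r} = card {j\<in>J. norm (v - z (h j)) \<le> r}" for r
  proof (rule bij_betw_same_card[symmetric, of h])
    show "bij_betw h {j\<in>J. norm (v - z (h j)) \<le> r} {i\<in>I. norm (v - z i) \<le> r}"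
      using h unfolding bij_betw_def by (auto intro: inj_on_subset)
  qed
  then have *: "nn_dist k v z I \<le> r \<longleftrightarrow> nn_dist k v (\<lambda>j. z (h j)) J \<le> r" for r
    using I assms by (simp add: nn_dist_le_iff)
  show "nn_dist k v z I \<le> nn_dist k v (\<lambda>j. z (h j)) J" using * by blast
  show "nn_dist k v (\<lambda>j. z (h j)) J \<le> nn_dist k v z I" using * by blast
qed

lemma nn_dist_nonneg: "0 \<le> nn_dist k v z I"
  by (simp add: nn_dist_def)

lemma nn_dist_attained:
  assumes "finite I" "1 \<le> k" "k \<le> card I"
  shows "\<exists>i\<in>I. nn_dist k v z I = norm (v - z i)"
proof -
  have "sort_key (\<lambda>i. norm (v - z i)) (sorted_list_of_set I) ! (k - 1)
      \<in> set (sort_key (\<lambda>i. norm (v - z i)) (sorted_list_of_set I))"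
    using assms by (intro nth_mem) auto
  then show ?thesis using assms by (auto simp: nn_dist_def nearest_neighbor_def)
qed

text \<open>The first \<open>l\<close> points all lie within the largest of their distances. The
  right side does not depend on \<open>m\<close>, and a sum, unlike a maximum, can be integrated
  term by term.\<close>

lemma nn_dist_le_sum:
  fixes g :: "real \<Rightarrow> real"
  assumes m: "1 \<le> l" "l \<le> m" and g: "mono g" "\<And>t. 0 \<le> g t"
  shows "g (nn_dist l v z {..<m}) \<le> (\<Sum>j<l. g (norm (v - z j)))"
proof -
  obtain i where i: "i < l" "\<And>j. j < l \<Longrightarrow> norm (v - z j) \<le> norm (v - z i)"
  proof -
    have "Max ((\<lambda>j. norm (v - z j)) ` {..<l}) \<in> (\<lambda>j. norm (v - z j)) ` {..<l}"
      using m by (intro Max_in) (auto simp: lessThan_empty_iff)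
    then obtain i where "i < l" "Max ((\<lambda>j. norm (v - z j)) ` {..<l}) = norm (v - z i)" by auto
    then show ?thesis using that[of i] by (metis Max_ge finite_imageI finite_lessThan imageI lessThan_iff)
  qed
  have "nn_dist l v z {..<m} \<le> norm (v - z i)"
  proof (subst nn_dist_le_iff)
    have "card {..<l} \<le> card {j \<in> {..<m}. norm (v - z j) \<le> norm (v - z i)}"
      using m i by (intro card_mono) auto
    then show "l \<le> card {j \<in> {..<m}. norm (v - z j) \<le> norm (v - z i)}" by simp
  qed (use m in auto)
  then have "g (nn_dist l v z {..<m}) \<le> g (norm (v - z i))" using g(1) by (auto dest: monoD)
  also have "\<dots> \<le> (\<Sum>j<l. g (norm (v - z j)))"
    using i g by (intro member_le_sum) auto
  finally show ?thesis .
qed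

lemma nn_dist_tendsto_0:
  assumes l: "1 \<le> l" and inf: "\<And>e. 0 < e \<Longrightarrow> infinite {j. norm (v - z j) \<le> e}"
  shows "(\<lambda>m. nn_dist l v z {..<m}) \<longlonglongrightarrow> 0"
proof (rule LIMSEQ_I)
  fix e :: real assume "0 < e"
  \<comment> \<open>Half of \<open>e\<close>, because the counting criterion yields a weak
    inequality and the limit asks for a strict one.\<close>
  then have "infinite {j. norm (v - z j) \<le> e / 2}" by (intro inf) simp
  then obtain T where T: "T \<subseteq> {j. norm (v - z j) \<le> e / 2}" "finite T" "card T = l"
    using infinite_arbitrarily_large by blast
  show "\<exists>no. \<forall>m\<ge>no. norm (nn_dist l v z {..<m} - 0) < e"
  proof (intro exI allI impI)
    fix m assume m: "m \<ge> max l (Suc (Max T))"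
    have "card T \<le> card {j \<in> {..<m}. norm (v - z j) \<le> e / 2}"
    proof (intro card_mono)
      show "T \<subseteq> {j \<in> {..<m}. norm (v - z j) \<le> e / 2}"
        using T m by (auto simp: less_Suc_eq_le Suc_le_eq intro: le_less_trans[OF Max_ge])
    qed auto
    then have "nn_dist l v z {..<m} \<le> e / 2"
      using T m l by (subst nn_dist_le_iff) auto
    then show "norm (nn_dist l v z {..<m} - 0) < e"
      using \<open>0 < e\<close> by (simp add: nn_dist_nonneg)
  qed
qed

lemma measurable_nn_dist:
  assumes l: "1 \<le> l" "l \<le> m"
    and [measurable]: "X \<in> borel_measurable M" "\<And>j. (\<lambda>\<omega>. Z \<omega> j) \<in> borel_measurable M"
  shows "(\<lambda>\<omega>. nn_dist l (X \<omega> :: 'a::euclidean_space) (Z \<omega>) {..<m}) \<in> borel_measurable M"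
proof (subst borel_measurable_iff_le, intro allI)
  fix r :: real
  have *: "(\<lambda>\<omega>. card {j \<in> {..<m}. norm (X \<omega> - Z \<omega> j) \<le> r}) =
      (\<lambda>\<omega>. \<Sum>j<m. if norm (X \<omega> - Z \<omega> j) \<le> r then 1 else (0::nat))"
    by (auto simp: fun_eq_iff sum.If_cases Int_def)
  have "(\<lambda>\<omega>. card {j \<in> {..<m}. norm (X \<omega> - Z \<omega> j) \<le> r}) \<in> measurable M (count_space UNIV)"
    unfolding * by measurable
  then have "{\<omega>\<in>space M. l \<le> card {j\<in>{..<m}. norm (X \<omega> - Z \<omega> j) \<le> r}} \<in> sets M"
    by measurable
  then show "{\<omega> \<in> space M. nn_dist l (X \<omega>) (Z \<omega>) {..<m} \<le> r} \<in> sets M"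
    using l by (subst nn_dist_le_iff) auto
qed

subsection \<open>Lebesgue differentiation\<close>

text \<open>Passes a comparison on single Vitali balls to their union. With a factor on each side it
  serves both directions, one factor being 1 each time.\<close>

lemma countable_disjoint_emeasure_mono:
  assumes "countable C" "disjoint_family_on A C" "sets M = sets N"
    and "\<And>i. i \<in> C \<Longrightarrow> A i \<in> sets N" "\<And>i. i \<in> C \<Longrightarrow> a * emeasure M (A i) \<le> b * emeasure N (A i)"
  shows "a * emeasure M (\<Union>i\<in>C. A i) \<le> b * emeasure N (\<Union>i\<in>C. A i)"
proof -
  have "a * emeasure M (\<Union>i\<in>C. A i) = (\<integral>\<^sup>+i. a * emeasure M (A i) \<partial>count_space C)"
    using assms by (subst emeasure_UN_countable) (auto simp: nn_integral_cmult)
  also have "\<dots> \<le> (\<integral>\<^sup>+i. b * emeasure N (A i) \<partial>count_space C)"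
    using assms by (intro nn_integral_mono) auto
  also have "\<dots> = b * emeasure N (\<Union>i\<in>C. A i)"
    using assms by (subst emeasure_UN_countable) (auto simp: nn_integral_cmult)
  finally show ?thesis .
qed

text \<open>Since \<open>U\<close> is open and admissible radii are arbitrarily small, every point
  of \<open>S\<close> still has a fine family of admissible balls inside \<open>U\<close>; Vitali's
  theorem selects the disjoint subfamily.\<close>

lemma Vitali_cball_cover:
  fixes S :: "'a::euclidean_space set"
  assumes U: "open U" "S \<subseteq> U" and fine: "\<And>x d. x \<in> S \<Longrightarrow> 0 < d \<Longrightarrow> \<exists>r. 0 < r \<and> r < d \<and> P x r"
  obtains C where "countable C" "disjoint_family_on (\<lambda>i. cball (fst i) (snd i)) C"
    "\<And>x r. (x, r) \<in> C \<Longrightarrow> P x r \<and> 0 < r"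
    "(\<Union>i\<in>C. cball (fst i) (snd i)) \<subseteq> U"
    "negligible (S - (\<Union>i\<in>C. cball (fst i) (snd i)))"
proof -
  define K where "K = {(x, r). 0 < r \<and> P x r \<and> cball x r \<subseteq> U}"
  obtain C where C: "countable C" "C \<subseteq> K"
      "pairwise (\<lambda>i j. disjnt (cball (fst i) (snd i)) (cball (fst j) (snd j))) C"
      "negligible (S - (\<Union>i\<in>C. cball (fst i) (snd i)))"
  proof (rule Vitali_covering_theorem_cballs[of K snd S fst])
    fix x and d :: real assume x: "x \<in> S" "0 < d"
    obtain e where e: "0 < e" "cball x e \<subseteq> U"
      using U x open_contains_cball by blast
    obtain r where "0 < r" "r < min d e" "P x r" using fine[of x "min d e"] x e by auto
    moreover have "cball x r \<subseteq> U" using e \<open>r < min d e\<close> by (auto simp: subset_iff)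
    ultimately show "\<exists>i. i \<in> K \<and> x \<in> cball (fst i) (snd i) \<and> snd i < d"
      by (intro exI[of _ "(x, r)"]) (auto simp: K_def)
  qed (auto simp: K_def)
  show ?thesis
  proof (rule that[OF C(1)])
    show "disjoint_family_on (\<lambda>i. cball (fst i) (snd i)) C"
      using C(3) by (auto simp: disjoint_family_on_def pairwise_def disjnt_def)
    show "(\<Union>i\<in>C. cball (fst i) (snd i)) \<subseteq> U"
      using C(2) by (force simp: K_def)
  qed (use C in \<open>auto simp: K_def\<close>)
qed

definition ball_volume :: "nat \<Rightarrow> real \<Rightarrow> real" where
  "ball_volume d r = unit_ball_vol (real d) * r ^ d"

lemma ball_volume_pos: "0 < r \<Longrightarrow> 0 < ball_volume d r"
  by (simp add: ball_volume_def)

text \<open>\<open>S\<close> is not assumed measurable, so negligibility is checked by outer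
  approximation. The constant \<open>c\<close> spares the callers a rescaling of
  \<open>e\<close>.\<close>

lemma negligible_if_small_cover:
  fixes S :: "'a::euclidean_space set"
  assumes "\<And>e. 0 < e \<Longrightarrow> \<exists>B\<in>sets borel. emeasure lborel B \<le> ennreal (c * e) \<and> negligible (S - B)"
    and "0 < c"
  shows "negligible S"
  unfolding negligible_outer_le
proof (intro allI impI)
  fix e :: real assume e: "0 < e"
  have "0 < e / c" "c * (e / c) = e" using e assms by auto
  then obtain B where B: "B \<in> sets borel" "emeasure lborel B \<le> ennreal e" "negligible (S - B)"
    using assms(1)[of "e / c"] by metis
  have "B \<in> lmeasurable"
    using B by (intro fmeasurableI) (auto intro: le_less_trans)
  moreover have "measure lebesgue B \<le> e"
    using B e by (simp add: measure_def enn2real_leI)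
  moreover have "S - B \<in> lmeasurable" "measure lebesgue (S - B) = 0"
    using B negligible_iff_measure by blast+
  ultimately show "\<exists>T. S \<subseteq> T \<and> T \<in> lmeasurable \<and> measure lebesgue T \<le> e"
    using measure_Un_le[of "S - B" lebesgue B]
    by (intro exI[of _ "(S - B) \<union> B"]) (auto intro: fmeasurableD simp del: Un_Diff_cancel2)
qed

section \<open>Masses of balls under a density and their differentiation\<close>

locale prob_density =
  fixes q :: "'a::euclidean_space \<Rightarrow> real"
  assumes density_measurable [measurable]: "q \<in> borel_measurable borel"
    and density_nonneg: "0 \<le> q x"
    and prob_space_density: "prob_space (density lborel (\<lambda>x. ennreal (q x)))"
begin

definition Q :: "'a measure" where "Q = density lborel (\<lambda>x. ennreal (q x))"

definition F :: "'a \<Rightarrow> real \<Rightarrow> real" where "F x r = measure Q (cball x r)"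

sublocale Q: prob_space Q
  using prob_space_density by (simp add: Q_def)

lemma sets_Q [simp, measurable_cong]: "sets Q = sets borel"
  by (simp add: Q_def)

lemma space_Q [simp]: "space Q = UNIV"
  by (simp add: Q_def)

lemma emeasure_Q_cball: "0 < r \<Longrightarrow> emeasure Q (cball x r) = ennreal (F x r)"
  by (simp add: F_def Q.emeasure_eq_measure)

lemma emeasure_lborel_cball: "0 < r \<Longrightarrow> emeasure lborel (cball (x::'a) r) = ennreal (ball_volume DIM('a) r)"
  by (simp add: emeasure_cball ball_volume_def)

lemma emeasure_Q: "A \<in> sets borel \<Longrightarrow> emeasure Q A = (\<integral>\<^sup>+x\<in>A. ennreal (q x) \<partial>lborel)"
  by (simp add: Q_def emeasure_density)

lemma emeasure_Q_le:
  assumes "A \<in> sets borel" "\<And>x. x \<in> A \<Longrightarrow> q x \<le> a"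
  shows "emeasure Q A \<le> ennreal a * emeasure lborel A"
proof -
  have "emeasure Q A \<le> (\<integral>\<^sup>+x. ennreal a * indicator A x \<partial>lborel)"
    using assms by (subst emeasure_Q) (auto intro!: nn_integral_mono ennreal_leI split: split_indicator)
  then show ?thesis using assms by (simp add: nn_integral_cmult_indicator)
qed

lemma emeasure_Q_ge:
  assumes "A \<in> sets borel" "\<And>x. x \<in> A \<Longrightarrow> b \<le> q x"
  shows "ennreal b * emeasure lborel A \<le> emeasure Q A"
proof -
  have "(\<integral>\<^sup>+x. ennreal b * indicator A x \<partial>lborel) \<le> emeasure Q A"
    using assms by (subst emeasure_Q) (auto intro!: nn_integral_mono ennreal_leI split: split_indicator)
  then show ?thesis using assms by (simp add: nn_integral_cmult_indicator)
qed

text \<open>Intersection of two outer approximations, one for each measure. The upper density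
  estimate uses smallness under \<open>Q\<close>, the lower one smallness under Lebesgue
  measure.\<close>

lemma open_superset_small:
  assumes E: "E \<in> sets borel" and e: "0 < e"
  obtains U where "open U" "E \<subseteq> U" "emeasure lborel (U - E) \<le> ennreal e" "emeasure Q (U - E) \<le> ennreal e"
proof -
  obtain U1 where U1: "open U1" "E \<subseteq> U1" "emeasure lebesgue (U1 - E) < ennreal e"
    using sets_lebesgue_outer_open[of E e] E e by auto
  have U1': "emeasure lborel (U1 - E) \<le> ennreal e"
    using U1 E by simp
  have "emeasure Q E = (INF U\<in>{U. E \<subseteq> U \<and> open U}. emeasure Q U)"
    using E by (intro outer_regular) (auto simp: Q.emeasure_eq_measure)
  moreover have "emeasure Q E < emeasure Q E + ennreal e"
    using e by (simp add: Q.emeasure_eq_measure ennreal_less_iff flip: ennreal_plus)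
  ultimately obtain U2 where U2: "E \<subseteq> U2" "open U2" "emeasure Q U2 < emeasure Q E + ennreal e"
    by (auto simp: INF_less_iff)
  have "emeasure Q (U2 - E) = emeasure Q U2 - emeasure Q E"
    using U2 E by (intro emeasure_Diff) auto
  also have "\<dots> \<le> ennreal e"
    using U2 by (subst ennreal_minus_le_iff) (auto simp: add.commute less_imp_le)
  finally have U2': "emeasure Q (U2 - E) \<le> ennreal e" .
  show ?thesis
  proof (rule that[of "U1 \<inter> U2"])
    show "emeasure lborel (U1 \<inter> U2 - E) \<le> ennreal e"
      using U1 U2 E by (intro order_trans[OF emeasure_mono U1']) auto
    show "emeasure Q (U1 \<inter> U2 - E) \<le> ennreal e"
      using U1 U2 E by (intro order_trans[OF emeasure_mono U2']) auto
  qed (use U1 U2 in auto)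
qed

text \<open>Cover by disjoint balls inside an open set \<open>U\<close> barely larger than \<open>E = {x. q x \<le> a'}\<close>: their union \<open>B\<close> satisfies
  \<open>a |B| \<le> Q B \<le> a' |B| + e\<close>. The lower estimate is dual.\<close>

lemma negligible_upper:
  assumes a: "0 \<le> a'" "a' < a"
  shows "negligible {x. q x \<le> a' \<and> (\<forall>d>0. \<exists>r. 0 < r \<and> r < d \<and> a * ball_volume DIM('a) r < F x r)}"
    (is "negligible ?S")
proof (rule negligible_if_small_cover)
  fix e :: real assume e: "0 < e"
  define E where "E = {x. q x \<le> a'}"
  have E [measurable]: "E \<in> sets borel" by (simp add: E_def)
  obtain U where U: "open U" "E \<subseteq> U" "emeasure Q (U - E) \<le> ennreal e"
    using open_superset_small[OF E e] by metis
  have SU: "?S \<subseteq> U" using U by (auto simp: E_def)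
  obtain C where C: "countable C" "disjoint_family_on (\<lambda>i. cball (fst i) (snd i)) C"
    "\<And>x r. (x, r) \<in> C \<Longrightarrow> a * ball_volume DIM('a) r < F x r \<and> 0 < r"
    "(\<Union>i\<in>C. cball (fst i) (snd i)) \<subseteq> U"
    "negligible (?S - (\<Union>i\<in>C. cball (fst i) (snd i)))"
    by (rule Vitali_cball_cover[OF U(1) SU, where P="\<lambda>x r. a * ball_volume DIM('a) r < F x r"]) auto
  define B where "B = (\<Union>i\<in>C. cball (fst i) (snd i))"
  have B [measurable]: "B \<in> sets borel" using C by (auto simp: B_def)
  have "ennreal a * emeasure lborel B \<le> 1 * emeasure Q B"
    unfolding B_def
  proof (rule countable_disjoint_emeasure_mono[OF C(1,2)])
    fix i assume "i \<in> C"
    then have "a * ball_volume DIM('a) (snd i) < F (fst i) (snd i)" "0 < snd i" using C(3)[of "fst i" "snd i"] by auto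
    then show "ennreal a * emeasure lborel (cball (fst i) (snd i)) \<le> 1 * emeasure Q (cball (fst i) (snd i))"
      using a by (simp add: emeasure_Q_cball emeasure_lborel_cball ball_volume_pos ennreal_leI less_imp_le flip: ennreal_mult)
  qed auto
  then have le1: "ennreal a * emeasure lborel B \<le> emeasure Q B" by simp
  have "emeasure Q B = emeasure Q (B \<inter> E) + emeasure Q (B - E)"
    by (subst plus_emeasure) (auto intro!: arg_cong[where f="emeasure Q"])
  also have "\<dots> \<le> ennreal a' * emeasure lborel (B \<inter> E) + ennreal e"
  proof (rule add_mono)
    show "emeasure Q (B \<inter> E) \<le> ennreal a' * emeasure lborel (B \<inter> E)"
      by (intro emeasure_Q_le) (auto simp: E_def)
    show "emeasure Q (B - E) \<le> ennreal e"
      using U C by (intro order_trans[OF emeasure_mono U(3)]) (auto simp: B_def)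
  qed
  also have "\<dots> \<le> ennreal a' * emeasure lborel B + ennreal e"
    by (intro add_mono mult_left_mono emeasure_mono) auto
  finally have le2: "emeasure Q B \<le> ennreal a' * emeasure lborel B + ennreal e" .
  \<comment> \<open>\<open>Q\<close> is finite and \<open>a > 0\<close>, so the volume of
    \<open>B\<close> is finite; only then may \<open>a'\<close> times that volume be
    subtracted.\<close>
  have "emeasure Q B < \<infinity>" by (simp add: Q.emeasure_eq_measure)
  then have "ennreal a * emeasure lborel B < \<infinity>" using le1 by (rule le_less_trans[rotated])
  then have "emeasure lborel B < \<infinity>"
    using a by (auto simp: ennreal_mult_less_top)
  then obtain t where t: "emeasure lborel B = ennreal t" "0 \<le> t" by (cases "emeasure lborel B") auto
  have "ennreal a * ennreal t \<le> ennreal a' * ennreal t + ennreal e" using le1 le2 t by auto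
  then have "a * t \<le> a' * t + e"
    using a t e by (simp flip: ennreal_mult ennreal_plus)
  then have "(a - a') * t \<le> e" by (simp add: algebra_simps)
  then have "t \<le> (1 / (a - a')) * e" using a by (simp add: field_simps)
  then show "\<exists>B\<in>sets borel. emeasure lborel B \<le> ennreal ((1 / (a - a')) * e) \<and> negligible (?S - B)"
    using B C t by (intro bexI[of _ B]) (auto simp: B_def intro!: ennreal_leI)
qed (use a in auto)

lemma negligible_lower:
  assumes a: "0 \<le> a" "a < b"
  shows "negligible {x. b \<le> q x \<and> (\<forall>d>0. \<exists>r. 0 < r \<and> r < d \<and> F x r < a * ball_volume DIM('a) r)}"
    (is "negligible ?S")
proof (rule negligible_if_small_cover)
  fix e :: real assume e: "0 < e"
  define E where "E = {x. b \<le> q x}"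
  have E [measurable]: "E \<in> sets borel" by (simp add: E_def)
  obtain U where U: "open U" "E \<subseteq> U" "emeasure lborel (U - E) \<le> ennreal e"
    using open_superset_small[OF E e] by metis
  have SU: "?S \<subseteq> U" using U by (auto simp: E_def)
  obtain C where C: "countable C" "disjoint_family_on (\<lambda>i. cball (fst i) (snd i)) C"
    "\<And>x r. (x, r) \<in> C \<Longrightarrow> F x r < a * ball_volume DIM('a) r \<and> 0 < r"
    "(\<Union>i\<in>C. cball (fst i) (snd i)) \<subseteq> U"
    "negligible (?S - (\<Union>i\<in>C. cball (fst i) (snd i)))"
    by (rule Vitali_cball_cover[OF U(1) SU, where P="\<lambda>x r. F x r < a * ball_volume DIM('a) r"]) auto
  define B where "B = (\<Union>i\<in>C. cball (fst i) (snd i))"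
  have B [measurable]: "B \<in> sets borel" using C by (auto simp: B_def)
  have "1 * emeasure Q B \<le> ennreal a * emeasure lborel B"
    unfolding B_def
  proof (rule countable_disjoint_emeasure_mono[OF C(1,2)])
    fix i assume "i \<in> C"
    then have "F (fst i) (snd i) < a * ball_volume DIM('a) (snd i)" "0 < snd i" using C(3)[of "fst i" "snd i"] by auto
    then show "1 * emeasure Q (cball (fst i) (snd i)) \<le> ennreal a * emeasure lborel (cball (fst i) (snd i))"
      using a by (simp add: emeasure_Q_cball emeasure_lborel_cball ball_volume_pos ennreal_leI less_imp_le flip: ennreal_mult)
  qed auto
  then have le1: "emeasure Q B \<le> ennreal a * emeasure lborel B" by simp
  have "ennreal b * emeasure lborel (B \<inter> E) \<le> emeasure Q (B \<inter> E)"
    by (intro emeasure_Q_ge) (auto simp: E_def)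
  also have "\<dots> \<le> emeasure Q B" by (intro emeasure_mono) auto
  finally have le2: "ennreal b * emeasure lborel (B \<inter> E) \<le> emeasure Q B" .
  have "emeasure Q B < \<infinity>" by (simp add: Q.emeasure_eq_measure)
  then have "ennreal b * emeasure lborel (B \<inter> E) < \<infinity>" using le2 by (rule le_less_trans[rotated])
  then have "emeasure lborel (B \<inter> E) < \<infinity>"
    using a by (auto simp: ennreal_mult_less_top)
  then obtain s where s: "emeasure lborel (B \<inter> E) = ennreal s" "0 \<le> s"
    by (cases "emeasure lborel (B \<inter> E)") auto
  have "emeasure lborel B = emeasure lborel (B \<inter> E) + emeasure lborel (B - E)"
    by (subst plus_emeasure) (auto intro!: arg_cong[where f="emeasure lborel"])
  also have "\<dots> \<le> ennreal s + ennreal e"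
    unfolding s using U C by (intro add_left_mono order_trans[OF emeasure_mono U(3)]) (auto simp: B_def)
  finally have t0: "emeasure lborel B \<le> ennreal (s + e)" using s e by (simp flip: ennreal_plus)
  then obtain t where t: "emeasure lborel B = ennreal t" "0 \<le> t"
    by (cases "emeasure lborel B") (auto simp: top_unique)
  have ts: "t \<le> s + e" using t t0 s e by (simp flip: ennreal_plus)
  have "ennreal b * ennreal s \<le> ennreal a * ennreal t" using le1 le2 t s by auto
  then have "b * s \<le> a * t"
    using a t s by (simp flip: ennreal_mult)
  moreover have "b * t \<le> b * (s + e)" using ts a by (intro mult_left_mono) auto
  \<comment> \<open>Combines \<open>b * s \<le> a * t\<close> with \<open>t \<le> s + e\<close>,
    where \<open>s\<close> and \<open>t\<close> are the volumes of \<open>B \<inter> E\<close> and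
    \<open>B\<close>.\<close>
  ultimately have "(b - a) * t \<le> b * e" by (simp add: algebra_simps)
  then have "t \<le> (b / (b - a)) * e" using a by (simp add: field_simps)
  then show "\<exists>B\<in>sets borel. emeasure lborel B \<le> ennreal ((b / (b - a)) * e) \<and> negligible (?S - B)"
    using B C t by (intro bexI[of _ B]) (auto simp: B_def intro!: ennreal_leI)
qed (use a in auto)

text \<open>Where convergence fails, two rationals separate \<open>q x\<close> from the ratios at
  arbitrarily small radii. There are countably many such pairs, each contributing a negligible
  set.\<close>

lemma Lebesgue_differentiation:
  "AE x in lborel. ((\<lambda>r. F x r / ball_volume DIM('a) r) \<longlongrightarrow> q x) (at_right 0)"
proof -
  define N where "N = (\<Union>(a, b)\<in>{(a::rat, b::rat). 0 \<le> a \<and> a < b}.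
     {x. q x \<le> of_rat a \<and> (\<forall>d>0. \<exists>r. 0 < r \<and> r < d \<and> of_rat b * ball_volume DIM('a) r < F x r)} \<union>
     {x. of_rat b \<le> q x \<and> (\<forall>d>0. \<exists>r. 0 < r \<and> r < d \<and> F x r < of_rat a * ball_volume DIM('a) r)})"
  have "negligible N"
    unfolding N_def
    by (rule negligible_countable_Union)
       (auto intro!: negligible_Un negligible_upper negligible_lower countable_image simp: of_rat_less)
  then have "AE x in lebesgue. x \<notin> N"
    by (intro AE_not_in) (simp add: negligible_iff_null_sets)
  then have "AE x in lborel. x \<notin> N" by (simp add: AE_completion_iff)
  then show ?thesis
  proof eventually_elim
    fix x assume x: "x \<notin> N"
    have xN: "(\<not> (q x \<le> of_rat a \<and> (\<forall>d>0. \<exists>r. 0 < r \<and> r < d \<and> of_rat b * ball_volume DIM('a) r < F x r))) \<and>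
       (\<not> (of_rat b \<le> q x \<and> (\<forall>d>0. \<exists>r. 0 < r \<and> r < d \<and> F x r < of_rat a * ball_volume DIM('a) r)))"
      if "0 \<le> a" "a < b" for a b
      using x that unfolding N_def by blast
    show "((\<lambda>r. F x r / ball_volume DIM('a) r) \<longlongrightarrow> q x) (at_right 0)"
    proof (rule order_tendstoI)
      fix c assume "c < q x"
      show "\<forall>\<^sub>F r in at_right 0. c < F x r / ball_volume DIM('a) r"
      \<comment> \<open>The pairs in \<open>N\<close> start at nonnegative rationals, so a negative
        \<open>c\<close> is settled by nonnegativity of the ratio.\<close>
      proof (cases "c < 0")
        case True
        have "0 \<le> F x r / ball_volume DIM('a) r" if "0 < r" for r
          using ball_volume_pos[OF that, of "DIM('a)"] by (intro divide_nonneg_pos) (simp add: F_def)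
        then show ?thesis using True
          by (intro eventually_at_rightI[of 0 1]) (auto intro: less_le_trans)
      next
        case False
        obtain b where b: "c < of_rat b" "of_rat b < q x" using \<open>c < q x\<close> of_rat_dense by blast
        obtain a where a: "c < of_rat a" "of_rat a < (of_rat b :: real)" using b of_rat_dense by blast
        have "0 < (of_rat a :: real)" using a False by linarith
        then have "0 \<le> a" "a < b" using a by (simp_all add: of_rat_less)
        from xN[OF this] b obtain d where d: "0 < d" "\<And>r. 0 < r \<Longrightarrow> r < d \<Longrightarrow> of_rat a * ball_volume DIM('a) r \<le> F x r"
          by (metis less_imp_le not_less)
        have "c < F x r / ball_volume DIM('a) r" if "0 < r" "r < d" for r
          using less_le_trans[OF mult_strict_right_mono[OF a(1)] d(2)[OF that]]
            ball_volume_pos[OF that(1), of "DIM('a)"]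
          by (simp add: pos_less_divide_eq)
        then show ?thesis using d(1) by (intro eventually_at_rightI[of 0 d]) auto
      qed
    next
      fix c assume "q x < c"
      obtain a where a: "q x < of_rat a" "of_rat a < c" using \<open>q x < c\<close> of_rat_dense by blast
      obtain b where b: "of_rat a < (of_rat b :: real)" "of_rat b < c" using a of_rat_dense by blast
      have "0 < (of_rat a :: real)" using a density_nonneg[of x] by linarith
      then have "0 \<le> a" "a < b" using b by (simp_all add: of_rat_less)
      from xN[OF this] a obtain d where d: "0 < d" "\<And>r. 0 < r \<Longrightarrow> r < d \<Longrightarrow> F x r \<le> of_rat b * ball_volume DIM('a) r"
        by (metis less_imp_le not_less)
      have "F x r / ball_volume DIM('a) r < c" if "0 < r" "r < d" for r
        using le_less_trans[OF d(2)[OF that] mult_strict_right_mono[OF b(2)]]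
            ball_volume_pos[OF that(1), of "DIM('a)"]
          by (simp add: pos_divide_less_eq)
      then show "\<forall>\<^sub>F r in at_right 0. F x r / ball_volume DIM('a) r < c"
        using d(1) by (intro eventually_at_rightI[of 0 d]) auto
    qed
  qed
qed

end

subsection \<open>Order statistics\<close>

text \<open>The distribution function is continuous but may have plateaus. Taking \<open>t\<close>
  as the right end of the plateau at level \<open>u\<close> makes the sublevel set exactly a
  half-line.\<close>

lemma (in real_distribution) cdf_level_exists:
  assumes atomless: "\<And>x. measure M {x} = 0" and u: "0 < u" "u < 1"
  obtains t where "cdf M t = u" "\<And>s. cdf M s \<le> u \<longleftrightarrow> s \<le> t"
proof -
  have cont: "continuous_on UNIV (cdf M)"
    using atomless isCont_cdf by (auto simp: continuous_on_eq_continuous_at)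
  have "\<forall>\<^sub>F x in at_bot. cdf M x < u"
    using cdf_lim_at_bot u(1) by (rule order_tendstoD)
  then obtain a where a: "cdf M a < u" by (auto simp: eventually_at_bot_linorder)
  have "\<forall>\<^sub>F x in at_top. u < cdf M x"
    using cdf_lim_at_top_prob u(2) by (rule order_tendstoD)
  then obtain b where b: "u < cdf M b" by (auto simp: eventually_at_top_linorder)
  have "a \<le> b" using a b cdf_nondecreasing[of b a] by linarith
  then obtain c where c: "cdf M c = u"
    using IVT'[of "cdf M" a u b] a b continuous_on_subset[OF cont] by auto
  \<comment> \<open>The intermediate value \<open>c\<close> is just some point of the plateau; the
    supremum of \<open>S\<close> is its right end.\<close>
  define S where "S = {s. cdf M s \<le> u}"
  have "closed S" unfolding S_def
    using closed_Collect_le[OF cont continuous_on_const] by simp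
  have bdd: "bdd_above S"
  proof (rule bdd_aboveI)
    fix s assume "s \<in> S"
    then show "s \<le> b" using b cdf_nondecreasing[of b s] by (cases "s \<le> b") (auto simp: S_def)
  qed
  have "c \<in> S" using c by (simp add: S_def)
  then have "Sup S \<in> S" using \<open>closed S\<close> bdd by (intro closed_contains_Sup) auto
  have "c \<le> Sup S" using \<open>c \<in> S\<close> bdd by (rule cSup_upper)
  then have "cdf M (Sup S) = u"
    using c cdf_nondecreasing[of c "Sup S"] \<open>Sup S \<in> S\<close> by (auto simp: S_def)
  moreover have "cdf M s \<le> u \<longleftrightarrow> s \<le> Sup S" for s
    using \<open>cdf M (Sup S) = u\<close> cdf_nondecreasing[of s "Sup S"] cSup_upper[OF _ bdd, of s]
    by (auto simp: S_def)
  ultimately show ?thesis by (rule that)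
qed

text \<open>Binomial tail: split according to the exact set of those indices below \<open>m\<close>
  whose sample lies in \<open>A\<close>, then group these sets by cardinality.\<close>

lemma emeasure_PiM_card_ge:
  assumes "prob_space Q" and A [measurable]: "A \<in> sets Q"
  shows "emeasure (PiM UNIV (\<lambda>_::nat. Q)) {y\<in>space (PiM UNIV (\<lambda>_. Q)). l \<le> card {j\<in>{..<m}. y j \<in> A}}
    = ennreal (\<Sum>i=l..m. real (m choose i) * measure Q A ^ i * (1 - measure Q A) ^ (m - i))"
proof -
  interpret Q: prob_space Q by fact
  interpret P: product_prob_space "\<lambda>_::nat. Q" UNIV ..
  let ?N = "PiM UNIV (\<lambda>_::nat. Q)"
  define u where "u = measure Q A"
  have u: "0 \<le> u" "u \<le> 1" by (auto simp: u_def)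
  \<comment> \<open>\<open>E S\<close>: among the first \<open>m\<close> coordinates, precisely
    those in \<open>S\<close> fall into \<open>A\<close>. These events are disjoint product
    cylinders.\<close>
  define E where "E = (\<lambda>S. {y\<in>space ?N. \<forall>j\<in>{..<m}. y j \<in> (if j \<in> S then A else space Q - A)})"
  have E_sets [measurable]: "E S \<in> sets ?N" for S
  proof -
    have "E S = {y\<in>space ?N. \<forall>j\<in>{..<m}. (j \<in> S \<longleftrightarrow> y j \<in> A)}"
      by (auto simp: E_def space_PiM PiE_iff)
    also have "\<dots> \<in> sets ?N" by measurable
    finally show ?thesis .
  qed
  have E_prob: "emeasure ?N (E S) = ennreal (u ^ card S * (1 - u) ^ (m - card S))" if "S \<subseteq> {..<m}" for S
  proof -
    have "emeasure ?N (E S) = (\<Prod>j<m. emeasure Q (if j \<in> S then A else space Q - A))"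
      unfolding E_def by (rule P.emeasure_PiM_Collect) auto
    also have "\<dots> = (\<Prod>j<m. ennreal (if j \<in> S then u else 1 - u))"
      by (intro prod.cong) (auto simp: Q.emeasure_eq_measure Q.prob_compl u_def)
    also have "\<dots> = ennreal (\<Prod>j<m. if j \<in> S then u else 1 - u)"
      using u by (intro prod_ennreal) auto
    also have "(\<Prod>j<m. if j \<in> S then u else 1 - u) = u ^ card S * (1 - u) ^ (m - card S)"
      using that by (simp add: prod.If_cases Int_absorb1 Diff_eq[symmetric] card_Diff_subset finite_subset)
    finally show ?thesis .
  qed
  have "{y\<in>space ?N. l \<le> card {j\<in>{..<m}. y j \<in> A}} = (\<Union>S\<in>{S. S \<subseteq> {..<m} \<and> l \<le> card S}. E S)"
  proof (intro set_eqI iffI)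
    fix y assume "y \<in> {y\<in>space ?N. l \<le> card {j\<in>{..<m}. y j \<in> A}}"
    then show "y \<in> (\<Union>S\<in>{S. S \<subseteq> {..<m} \<and> l \<le> card S}. E S)"
      by (intro UN_I[of "{j\<in>{..<m}. y j \<in> A}"]) (auto simp: E_def space_PiM PiE_iff)
  next
    fix y assume "y \<in> (\<Union>S\<in>{S. S \<subseteq> {..<m} \<and> l \<le> card S}. E S)"
    then obtain S where S: "S \<subseteq> {..<m}" "l \<le> card S" "y \<in> E S" by auto
    then have "{j\<in>{..<m}. y j \<in> A} = S" by (auto simp: E_def split: if_splits)
    then show "y \<in> {y\<in>space ?N. l \<le> card {j\<in>{..<m}. y j \<in> A}}" using S by (auto simp: E_def)
  qed
  also have "emeasure ?N \<dots> = (\<Sum>S\<in>{S. S \<subseteq> {..<m} \<and> l \<le> card S}. emeasure ?N (E S))"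
  proof (rule sum_emeasure[symmetric])
    have "S = {j\<in>{..<m}. y j \<in> A}" if "S \<subseteq> {..<m}" "y \<in> E S" for S y
      using that by (auto simp: E_def split: if_splits)
    then show "disjoint_family_on E {S. S \<subseteq> {..<m} \<and> l \<le> card S}"
      unfolding disjoint_family_on_def by blast
  qed auto
  also have "\<dots> = (\<Sum>S\<in>{S. S \<subseteq> {..<m} \<and> l \<le> card S}. ennreal (u ^ card S * (1 - u) ^ (m - card S)))"
    by (intro sum.cong E_prob) auto
  also have "\<dots> = ennreal (\<Sum>S\<in>{S. S \<subseteq> {..<m} \<and> l \<le> card S}. u ^ card S * (1 - u) ^ (m - card S))"
    using u by (intro sum_ennreal) auto
  also have "(\<Sum>S\<in>{S. S \<subseteq> {..<m} \<and> l \<le> card S}. u ^ card S * (1 - u) ^ (m - card S))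
      = (\<Sum>i=l..m. \<Sum>S\<in>{S\<in>{S. S \<subseteq> {..<m} \<and> l \<le> card S}. card S = i}. u ^ card S * (1 - u) ^ (m - card S))"
    by (rule sum.group[symmetric]) (auto dest: card_mono[rotated])
  also have "\<dots> = (\<Sum>i=l..m. real (m choose i) * u ^ i * (1 - u) ^ (m - i))"
  proof (rule sum.cong[OF refl])
    fix i assume i: "i \<in> {l..m}"
    then have "{S\<in>{S. S \<subseteq> {..<m} \<and> l \<le> card S}. card S = i} = {S. S \<subseteq> {..<m} \<and> card S = i}" by auto
    then show "(\<Sum>S\<in>{S\<in>{S. S \<subseteq> {..<m} \<and> l \<le> card S}. card S = i}. u ^ card S * (1 - u) ^ (m - card S))
      = real (m choose i) * u ^ i * (1 - u) ^ (m - i)"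
      by (simp add: n_subsets)
  qed
  finally show ?thesis by (simp add: u_def)
qed

lemma binomial_Beta:
  assumes "1 \<le> i" "i \<le> m"
  shows "real (m choose i) * Beta (real i) (real (m - i) + 1) = 1 / real i"
proof -
  obtain i' where i': "i = Suc i'" using assms by (cases i) auto
  have "real i + (real (m - i) + 1) = real m + 1" using assms by simp
  then have "Beta (real i) (real (m - i) + 1) = fact i' * fact (m - i) / fact m"
    unfolding Beta_def using Gamma_fact[of i', where 'a=real] Gamma_fact[of "m - i", where 'a=real]
      Gamma_fact[of m, where 'a=real]
    by (simp add: i' add.commute)
  then show ?thesis using assms by (simp add: binomial_fact i')
qed

text \<open>Divided by \<open>u\<close>, the \<open>i\<close>-th term of the tail is a multiple of
  the integrand of \<open>Beta i (m - i + 1)\<close>, and its integral is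
  \<open>1 / i\<close>.\<close>

lemma nn_integral_binomial_tail:
  assumes l: "1 \<le> l"
  shows "(\<integral>\<^sup>+u. ennreal ((1 / u) * (\<Sum>i=l..m. real (m choose i) * u ^ i * (1 - u) ^ (m - i)))
      * indicator {0<..<1} u \<partial>lborel) = ennreal (\<Sum>i=l..m. 1 / real i)"
proof -
  have Beta: "(\<integral>\<^sup>+u. ennreal (u powr (real i - 1) * (1 - u) powr (real (m - i) + 1 - 1))
      * indicator {0..1} u \<partial>lborel) = ennreal (Beta (real i) (real (m - i) + 1))" if "i \<in> {l..m}" for i
    using that l by (intro nn_integral_has_integral_lebesgue' has_integral_Beta_real) auto
  have "(\<integral>\<^sup>+u. ennreal ((1 / u) * (\<Sum>i=l..m. real (m choose i) * u ^ i * (1 - u) ^ (m - i)))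
      * indicator {0<..<1} u \<partial>lborel)
    = (\<integral>\<^sup>+u. (\<Sum>i=l..m. ennreal (real (m choose i)) *
         (ennreal (u powr (real i - 1) * (1 - u) powr (real (m - i) + 1 - 1)) * indicator {0..1} u)) \<partial>lborel)"
  proof (rule nn_integral_cong_AE)
    show "AE u in lborel. ennreal ((1 / u) * (\<Sum>i=l..m. real (m choose i) * u ^ i * (1 - u) ^ (m - i)))
      * indicator {0<..<1} u = (\<Sum>i=l..m. ennreal (real (m choose i)) *
         (ennreal (u powr (real i - 1) * (1 - u) powr (real (m - i) + 1 - 1)) * indicator {0..1} u))"
      using AE_lborel_singleton[of "0::real"] AE_lborel_singleton[of "1::real"]
    proof eventually_elim
      fix u :: real assume u01: "u \<noteq> 0" "u \<noteq> 1"
      show "ennreal ((1 / u) * (\<Sum>i=l..m. real (m choose i) * u ^ i * (1 - u) ^ (m - i)))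
          * indicator {0<..<1} u = (\<Sum>i=l..m. ennreal (real (m choose i)) *
         (ennreal (u powr (real i - 1) * (1 - u) powr (real (m - i) + 1 - 1)) * indicator {0..1} u))"
      proof (cases "0 < u \<and> u < 1")
        case True
        have "(1 / u) * (\<Sum>i=l..m. real (m choose i) * u ^ i * (1 - u) ^ (m - i)) =
          (\<Sum>i=l..m. real (m choose i) * (u powr (real i - 1) * (1 - u) powr (real (m - i) + 1 - 1)))"
          unfolding sum_distrib_left
        proof (rule sum.cong[OF refl])
          fix i assume "i \<in> {l..m}"
          then have "u powr (real i - 1) = u ^ i / u"
            using True l by (simp add: powr_diff powr_realpow)
          moreover have "(1 - u) powr (real (m - i) + 1 - 1) = (1 - u) ^ (m - i)"
            using True by (simp add: powr_realpow)
          ultimately show "1 / u * (real (m choose i) * u ^ i * (1 - u) ^ (m - i)) =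
              real (m choose i) * (u powr (real i - 1) * (1 - u) powr (real (m - i) + 1 - 1))"
            by simp
        qed
        then show ?thesis using True
          by (simp only: ennreal_mult[symmetric] powr_ge_zero mult_nonneg_nonneg sum_ennreal
              of_nat_0_le_iff) (simp add: sum_ennreal ennreal_mult''[symmetric])
      next
        case False
        then show ?thesis using u01 by (auto simp: indicator_def)
      qed
    qed
  qed
  also have "\<dots> = (\<Sum>i=l..m. ennreal (real (m choose i)) * ennreal (Beta (real i) (real (m - i) + 1)))"
    using Beta by (subst nn_integral_sum) (auto simp: nn_integral_cmult intro!: sum.cong)
  also have "\<dots> = (\<Sum>i=l..m. ennreal (1 / real i))"
  proof (rule sum.cong[OF refl])
    fix i assume i: "i \<in> {l..m}"
    have "ennreal (real (m choose i)) * ennreal (Beta (real i) (real (m - i) + 1)) =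
        ennreal (real (m choose i) * Beta (real i) (real (m - i) + 1))"
      by (simp only: ennreal_mult' of_nat_0_le_iff)
    then show "ennreal (real (m choose i)) * ennreal (Beta (real i) (real (m - i) + 1)) = ennreal (1 / real i)"
      using i l by (simp only: binomial_Beta atLeastAtMost_iff order_trans[of 1 l i])
  qed
  also have "\<dots> = ennreal (\<Sum>i=l..m. 1 / real i)"
    by (intro sum_ennreal) auto
  finally show ?thesis .
qed

text \<open>Layer-cake form of the logarithm. With Tonelli it turns the mean of
  \<open>- ln U\<close> into the integral of \<open>P(U \<le> u) / u\<close> over the unit interval,
  so only the distribution function of \<open>U\<close> is needed.\<close>

lemma ennreal_neg_ln_eq_nn_integral:
  assumes "0 < v" "v \<le> 1"
  shows "ennreal (- ln v) = (\<integral>\<^sup>+u. ennreal (1 / u) * indicator {v..} u * indicator {0<..<1} u \<partial>lborel)"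
proof -
  have "(\<integral>\<^sup>+u. ennreal (1 / u) * indicator {v..} u * indicator {0<..<1} u \<partial>lborel) =
      (\<integral>\<^sup>+u. ennreal (1 / u) * indicator {v..1} u \<partial>lborel)"
    using AE_lborel_singleton[of "1::real"] assms
    by (intro nn_integral_cong_AE) (auto simp: indicator_def)
  also have "\<dots> = ln 1 - ln v"
    using assms by (intro nn_integral_FTC_Icc) (auto intro!: derivative_eq_intros)
  finally show ?thesis by simp
qed

section \<open>The mass of the ball reaching to the nearest neighbor\<close>

context prob_density
begin

lemma F_eq_cdf: "F x = cdf (distr Q borel (\<lambda>y. norm (x - y)))"
proof
  fix r
  have "(\<lambda>y. norm (x - y)) -` {..r} \<inter> space Q = cball x r" by (auto simp: dist_norm)
  then show "F x r = cdf (distr Q borel (\<lambda>y. norm (x - y))) r"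
    unfolding F_def cdf_def by (subst measure_distr) auto
qed

lemma real_distribution_dist: "real_distribution (distr Q borel (\<lambda>y. norm (x - y)))"
  by (intro Q.real_distribution_distr) measurable

text \<open>Spheres are Lebesgue null and \<open>Q\<close> has a density. Positive radii make
  distances atomless; radius 0 shows that \<open>Q\<close> has no point masses.\<close>

lemma measure_Q_sphere: "measure Q (sphere x r) = 0"
proof -
  have "sphere x r \<in> null_sets lebesgue" using negligible_sphere negligible_iff_null_sets by blast
  then have "emeasure lborel (sphere x r) = 0" by (auto dest: null_setsD1)
  then have "sphere x r \<in> null_sets lborel" by auto
  then have "sphere x r \<in> null_sets Q" unfolding Q_def
    by (subst null_sets_density_iff) (auto intro: AE_I'[of "sphere x r"])
  then show ?thesis by (simp add: measure_eq_0_null_sets)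
qed

lemma dist_atomless: "measure (distr Q borel (\<lambda>y. norm (x - y))) {r} = 0"
proof -
  have "(\<lambda>y. norm (x - y)) -` {r} \<inter> space Q = sphere x r" by (auto simp: dist_norm)
  then show ?thesis using measure_Q_sphere by (subst measure_distr) auto
qed

lemma F_mono: "r \<le> s \<Longrightarrow> F x r \<le> F x s"
  unfolding F_def by (intro Q.finite_measure_mono) auto

lemma F_nonneg: "0 \<le> F x r" and F_le_1: "F x r \<le> 1"
  by (auto simp: F_def)

lemma F_continuous: "continuous_on UNIV (F x)"
proof -
  interpret D: real_distribution "distr Q borel (\<lambda>y. norm (x - y))" by (rule real_distribution_dist)
  show ?thesis unfolding F_eq_cdf
    using dist_atomless D.isCont_cdf by (auto simp: continuous_on_eq_continuous_at)
qed

lemma F_level_exists: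
  assumes "0 < u" "u < 1"
  obtains t where "F x t = u" "\<And>s. F x s \<le> u \<longleftrightarrow> s \<le> t"
  using real_distribution.cdf_level_exists[OF real_distribution_dist dist_atomless assms]
  unfolding F_eq_cdf by metis

text \<open>Closed balls are the sections of the measurable set \<open>dist x y \<le> r\<close>, and
  measures of sections are measurable. Joint measurability is required because the radius is
  random.\<close>

lemma F_measurable [measurable]:
  assumes [measurable]: "X \<in> borel_measurable M" "R \<in> borel_measurable M"
  shows "(\<lambda>\<omega>. F (X \<omega>) (R \<omega>)) \<in> borel_measurable M"
proof -
  let ?D = "{(z::'a \<times> real, y). dist (fst z) y \<le> snd z}"
  have "{w\<in>space ((borel \<Otimes>\<^sub>M borel) \<Otimes>\<^sub>M Q). dist (fst (fst w)) (snd w) \<le> snd (fst w)}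
      \<in> sets ((borel \<Otimes>\<^sub>M borel) \<Otimes>\<^sub>M Q)"
    by measurable
  also have "{w\<in>space ((borel \<Otimes>\<^sub>M borel) \<Otimes>\<^sub>M Q). dist (fst (fst w)) (snd w) \<le> snd (fst w)} = ?D"
    by (auto simp: space_pair_measure)
  finally have "(\<lambda>z. emeasure Q (Pair z -` ?D)) \<in> borel_measurable (borel \<Otimes>\<^sub>M borel)"
    by (rule Q.measurable_emeasure_Pair)
  moreover have "Pair z -` ?D = cball (fst z) (snd z)" for z :: "'a \<times> real"
    by auto
  ultimately have "(\<lambda>z. emeasure Q (cball (fst z) (snd z))) \<in> borel_measurable (borel \<Otimes>\<^sub>M borel)"
    by (simp only:)
  then have [measurable]: "(\<lambda>z. F (fst z) (snd z)) \<in> borel_measurable (borel \<Otimes>\<^sub>M borel)"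
    unfolding F_def measure_def by (rule borel_measurable_enn2real)
  have "(\<lambda>\<omega>. (\<lambda>z. F (fst z) (snd z)) (X \<omega>, R \<omega>)) \<in> borel_measurable M" by measurable
  then show ?thesis by simp
qed

abbreviation "samples \<equiv> PiM UNIV (\<lambda>_::nat. Q)"

lemma prob_space_samples: "prob_space samples"
  by (intro prob_space_PiM Q.prob_space_axioms)

lemma AE_sample_neq: "AE y in samples. \<forall>j. y j \<noteq> x"
proof -
  have "AE y in samples. y j \<noteq> x" for j
  proof -
    have "AE y in Q. y \<noteq> x"
    proof (rule AE_I'[of "{x}"])
      show "{x} \<in> null_sets Q"
        using measure_Q_sphere[of x 0] by (auto simp: null_sets_def Q.emeasure_eq_measure)
    qed auto
    then have "AE y in distr samples Q (\<lambda>y. y j). y \<noteq> x"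
      by (subst distr_PiM_component) (auto intro: Q.prob_space_axioms)
    then show ?thesis by (subst (asm) AE_distr_iff) auto
  qed
  then show ?thesis by (simp add: AE_all_countable)
qed

text \<open>By the layer-cake form the mean is an integral over levels \<open>u\<close> of the
  probability that at least \<open>l\<close> of \<open>m\<close> points fall into a ball of mass
  exactly \<open>u\<close>. This binomial tail does not depend on \<open>x\<close> or
  \<open>q\<close>.\<close>

lemma nn_integral_neg_ln_F_nn_dist:
  assumes pos: "\<And>r. 0 < r \<Longrightarrow> 0 < F x r" and l: "1 \<le> l" "l \<le> m"
  shows "(\<integral>\<^sup>+y. ennreal (- ln (F x (nn_dist l x y {..<m}))) \<partial>samples) = ennreal (\<Sum>i=l..m. 1 / real i)"
proof -
  interpret S: prob_space samples by (rule prob_space_samples)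
  interpret pair_sigma_finite samples lborel ..
  have [measurable]: "(\<lambda>y. nn_dist l x y {..<m}) \<in> borel_measurable samples"
    using l by (intro measurable_nn_dist) measurable
  let ?U = "\<lambda>y. F x (nn_dist l x y {..<m})"
  have "(\<integral>\<^sup>+y. ennreal (- ln (?U y)) \<partial>samples) =
      (\<integral>\<^sup>+y. (\<integral>\<^sup>+u. ennreal (1 / u) * indicator {?U y..} u * indicator {0<..<1} u \<partial>lborel) \<partial>samples)"
  proof (rule nn_integral_cong_AE)
    show "AE y in samples. ennreal (- ln (?U y)) =
        (\<integral>\<^sup>+u. ennreal (1 / u) * indicator {?U y..} u * indicator {0<..<1} u \<partial>lborel)"
      using AE_sample_neq[of x]
    proof eventually_elim
      fix y :: "nat \<Rightarrow> 'a" assume y: "\<forall>j. y j \<noteq> x"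
      have "0 < nn_dist l x y {..<m}"
        using nn_dist_attained[of "{..<m}" l x y] l y by auto
      then show "ennreal (- ln (?U y)) =
          (\<integral>\<^sup>+u. ennreal (1 / u) * indicator {?U y..} u * indicator {0<..<1} u \<partial>lborel)"
        using pos F_le_1 by (intro ennreal_neg_ln_eq_nn_integral) auto
    qed
  qed
  also have "\<dots> = (\<integral>\<^sup>+u. (\<integral>\<^sup>+y. ennreal (1 / u) * indicator {?U y..} u * indicator {0<..<1} u \<partial>samples) \<partial>lborel)"
  proof (rule Fubini'[symmetric])
    \<comment> \<open>The set under the indicator varies with \<open>y\<close>; written as a
      conditional, the integrand is visibly jointly measurable.\<close>
    have "(\<lambda>(y, u). ennreal (1 / u) * (if ?U y \<le> u then 1 else 0) * indicator {0<..<1} u)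
        \<in> borel_measurable (samples \<Otimes>\<^sub>M lborel)"
      by measurable
    then show "(\<lambda>(y, u). ennreal (1 / u) * indicator {?U y..} u * indicator {0<..<1} u)
        \<in> borel_measurable (samples \<Otimes>\<^sub>M lborel)"
      by (simp add: indicator_def)
  qed
  also have "\<dots> = (\<integral>\<^sup>+u. ennreal ((1 / u) * (\<Sum>i=l..m. real (m choose i) * u ^ i * (1 - u) ^ (m - i)))
      * indicator {0<..<1} u \<partial>lborel)"
  proof (rule nn_integral_cong)
    fix u :: real
    show "(\<integral>\<^sup>+y. ennreal (1 / u) * indicator {?U y..} u * indicator {0<..<1} u \<partial>samples) =
      ennreal ((1 / u) * (\<Sum>i=l..m. real (m choose i) * u ^ i * (1 - u) ^ (m - i))) * indicator {0<..<1} u"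
    proof (cases "0 < u \<and> u < 1")
      case True
      then obtain t where t: "F x t = u" "\<And>s. F x s \<le> u \<longleftrightarrow> s \<le> t" using F_level_exists by metis
      \<comment> \<open>Since \<open>t\<close> is the right end of the level,
        \<open>?U y \<le> u\<close> means that the distance is at most \<open>t\<close>, which the
        counting criterion expresses.\<close>
      have ev: "{y\<in>space samples. ?U y \<le> u} = {y\<in>space samples. l \<le> card {j\<in>{..<m}. y j \<in> cball x t}}"
        using l by (simp add: t nn_dist_le_iff dist_norm)
      have "(\<integral>\<^sup>+y. ennreal (1 / u) * indicator {?U y..} u * indicator {0<..<1} u \<partial>samples) =
          (\<integral>\<^sup>+y. ennreal (1 / u) * indicator {y\<in>space samples. ?U y \<le> u} y \<partial>samples)"
        using True by (intro nn_integral_cong) (auto simp: indicator_def)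
      also have "\<dots> = ennreal (1 / u) * emeasure samples {y\<in>space samples. ?U y \<le> u}"
        by (intro nn_integral_cmult_indicator) measurable
      also have "\<dots> = ennreal (1 / u) * ennreal (\<Sum>i=l..m. real (m choose i) * u ^ i * (1 - u) ^ (m - i))"
        unfolding ev using t(1) by (subst emeasure_PiM_card_ge) (auto simp: F_def Q.prob_space_axioms)
      finally show ?thesis using True by (simp add: ennreal_mult'[symmetric])
    next
      case False
      then have "indicator {0<..<1} u = (0::ennreal)" by (auto simp: indicator_def)
      then show ?thesis by simp
    qed
  qed
  also have "\<dots> = ennreal (\<Sum>i=l..m. 1 / real i)"
    using l(1) by (rule nn_integral_binomial_tail)
  finally show ?thesis .
qed

end

subsection \<open>Integrability of the logarithmic ball averages\<close>

lemma ennreal_rpow_mono: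
  assumes "u \<le> v" "0 < a"
  shows "ennreal_rpow u a \<le> ennreal_rpow v a"
proof (cases "v = \<infinity>")
  case False
  then have "u \<noteq> \<infinity>" using assms by (auto simp: top_unique)
  then show ?thesis using False assms
    by (auto simp: ennreal_rpow_def less_top intro!: ennreal_leI powr_mono2 enn2real_mono)
qed (simp add: ennreal_rpow_def)

lemma unit_ball_vol_nonzero: "unit_ball_vol (real n) \<noteq> 0"
  using unit_ball_vol_pos[of "real n"] by (metis less_irrefl of_nat_0_le_iff)

text \<open>From \<open>ln s \<le> s - 1\<close> with \<open>s = t powr e\<close>; for
  \<open>t = 0\<close> the convention \<open>ln 0 = 0\<close> makes the left side vanish.\<close>

lemma mult_ln_le_powr: "0 < e \<Longrightarrow> 0 \<le> t \<Longrightarrow> e * ln t \<le> t powr e" for t :: real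
proof (cases "t = 0")
  case False
  assume "0 < e" "0 \<le> t"
  then have "ln (t powr e) \<le> t powr e - 1" using False by (intro ln_le_minus_one) auto
  then show ?thesis using False by (simp add: ln_powr)
qed auto

text \<open>Price of comparing radii above \<open>R\<close> with \<open>R\<close> itself, from
  \<open>ln (ball_volume d r) = ln (ball_volume d R) + d * (ln r - ln R)\<close>.\<close>

definition ln_ratio_const :: "nat \<Rightarrow> real \<Rightarrow> real" where
  "ln_ratio_const d R = \<bar>ln (ball_volume d R)\<bar> + real d * \<bar>ln R\<bar>"

context prob_density
begin

definition ratio :: "'a \<Rightarrow> real \<Rightarrow> real" where
  "ratio x r = F x r / ball_volume DIM('a) r"

lemma ratio_nonneg: "0 < r \<Longrightarrow> 0 \<le> ratio x r"
  unfolding ratio_def using F_nonneg ball_volume_pos by (intro divide_nonneg_pos)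

lemma ratio_measurable [measurable]:
  assumes [measurable]: "X \<in> borel_measurable M" "R \<in> borel_measurable M"
  shows "(\<lambda>\<omega>. ratio (X \<omega>) (R \<omega>)) \<in> borel_measurable M"
  unfolding ratio_def ball_volume_def by measurable

lemma ball_average_eq: "0 < r \<Longrightarrow> ball_average q x r = ennreal (ratio x r)"
proof -
  assume r: "0 < r"
  have "(\<integral>\<^sup>+y\<in>cball x r. ennreal (q y) \<partial>lborel) = ennreal (F x r)"
    using r by (simp add: emeasure_Q_cball flip: emeasure_Q)
  moreover have "r ^ DIM('a) * measure lborel (cball (0::'a) 1) = ball_volume DIM('a) r"
    by (simp add: ball_volume_def content_cball mult.commute)
  ultimately show ?thesis
    unfolding ball_average_def ratio_def
    using r F_nonneg ball_volume_pos by (simp add: divide_ennreal)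
qed

text \<open>The suprema run over rational radii only, which makes them measurable in \<open>x\<close>; the integrands of
  \<open>Q_fun\<close> and \<open>T_fun\<close> are never shown to be measurable.\<close>

definition sup_ln :: "real \<Rightarrow> 'a \<Rightarrow> ennreal" where
  "sup_ln R x = (SUP r\<in>{0<..<R} \<inter> \<rat>. ennreal (ln (ratio x r)))"

text \<open>A vanishing ratio must count as infinite, whereas \<open>ln 0 = 0\<close> would hide it.
  Elsewhere \<open>ennreal\<close> keeps only the positive part of \<open>- ln\<close>.\<close>

definition sup_neg_ln :: "real \<Rightarrow> 'a \<Rightarrow> ennreal" where
  "sup_neg_ln R x = (SUP r\<in>{0<..<R} \<inter> \<rat>. if ratio x r = 0 then \<infinity> else ennreal (- ln (ratio x r)))"

lemma sup_ln_measurable [measurable]: "sup_ln R \<in> borel_measurable borel"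
  unfolding sup_ln_def by (intro borel_measurable_SUP countable_Int2 countable_rat) measurable

lemma sup_neg_ln_measurable [measurable]: "sup_neg_ln R \<in> borel_measurable borel"
  unfolding sup_neg_ln_def by (intro borel_measurable_SUP countable_Int2 countable_rat) measurable

lemma sup_ln_mono: "R \<le> R' \<Longrightarrow> sup_ln R x \<le> sup_ln R' x"
  unfolding sup_ln_def by (intro SUP_subset_mono) auto

lemma sup_neg_ln_mono: "R \<le> R' \<Longrightarrow> sup_neg_ln R x \<le> sup_neg_ln R' x"
  unfolding sup_neg_ln_def by (intro SUP_subset_mono) auto

lemma sup_ln_le_rpow:
  assumes "0 < \<epsilon>"
  shows "ennreal \<epsilon> * sup_ln R x \<le> ennreal_rpow (M_fun q x R) \<epsilon>"
proof (cases "{0<..<R} \<inter> \<rat> = {}")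
  case True
  then show ?thesis by (simp add: sup_ln_def bot_ennreal)
next
  case False
  have "ennreal \<epsilon> * sup_ln R x = (SUP r\<in>{0<..<R} \<inter> \<rat>. ennreal \<epsilon> * ennreal (ln (ratio x r)))"
    unfolding sup_ln_def by (rule SUP_mult_left_ennreal)
  also have "\<dots> \<le> ennreal_rpow (M_fun q x R) \<epsilon>"
  proof (rule SUP_least)
    fix r assume r: "r \<in> {0<..<R} \<inter> \<rat>"
    have "ennreal \<epsilon> * ennreal (ln (ratio x r)) = ennreal (\<epsilon> * ln (ratio x r))"
      using assms by (simp add: ennreal_mult')
    also have "\<dots> \<le> ennreal_rpow (ball_average q x r) \<epsilon>"
      using r assms ratio_nonneg[of r x]
      by (auto simp: ball_average_eq ennreal_rpow_def intro!: ennreal_leI mult_ln_le_powr)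
    also have "\<dots> \<le> ennreal_rpow (M_fun q x R) \<epsilon>"
      unfolding M_fun_def using r assms by (intro ennreal_rpow_mono SUP_upper) auto
    finally show "ennreal \<epsilon> * ennreal (ln (ratio x r)) \<le> ennreal_rpow (M_fun q x R) \<epsilon>" .
  qed
  finally show ?thesis .
qed

text \<open>The logarithm bound is applied to the inverse ratio, which is at most the inverse of
  \<open>m_fun\<close>. If \<open>m_fun\<close> vanishes, the right side is infinite.\<close>

lemma sup_neg_ln_le_rpow:
  assumes "0 < \<epsilon>"
  shows "ennreal \<epsilon> * sup_neg_ln R x \<le> inverse (ennreal_rpow (m_fun q x R) \<epsilon>)"
proof -
  have "ennreal \<epsilon> * sup_neg_ln R x = (SUP r\<in>{0<..<R} \<inter> \<rat>.
      ennreal \<epsilon> * (if ratio x r = 0 then \<infinity> else ennreal (- ln (ratio x r))))"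
    unfolding sup_neg_ln_def by (rule SUP_mult_left_ennreal)
  also have "\<dots> \<le> inverse (ennreal_rpow (m_fun q x R) \<epsilon>)"
  proof (rule SUP_least)
    fix r assume r: "r \<in> {0<..<R} \<inter> \<rat>"
    have "m_fun q x R \<le> ball_average q x r"
      unfolding m_fun_def using r by (intro INF_lower) auto
    then have le: "m_fun q x R \<le> ennreal (ratio x r)" using r by (simp add: ball_average_eq)
    then obtain t where t: "m_fun q x R = ennreal t" "0 \<le> t"
      by (cases "m_fun q x R") (auto simp: top_unique)
    have tr: "t \<le> ratio x r" using le t r ratio_nonneg[of r x] by simp
    show "ennreal \<epsilon> * (if ratio x r = 0 then \<infinity> else ennreal (- ln (ratio x r)))
        \<le> inverse (ennreal_rpow (m_fun q x R) \<epsilon>)"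
    proof (cases "t = 0")
      case True
      then show ?thesis using t assms by (simp add: ennreal_rpow_def)
    next
      case False
      then have tpos: "0 < t" "0 < ratio x r" using t tr by auto
      have "\<epsilon> * - ln (ratio x r) = \<epsilon> * ln (inverse (ratio x r))"
        using tpos by (simp add: ln_inverse)
      also have "\<dots> \<le> inverse (ratio x r) powr \<epsilon>"
        using tpos assms by (intro mult_ln_le_powr) auto
      also have "\<dots> \<le> inverse t powr \<epsilon>"
        using tpos tr assms by (intro powr_mono2) (auto simp: le_imp_inverse_le)
      also have "\<dots> = inverse (t powr \<epsilon>)" using tpos by (simp add: inverse_powr)
      finally have "ennreal (\<epsilon> * - ln (ratio x r)) \<le> ennreal (inverse (t powr \<epsilon>))" by (rule ennreal_leI)
      then show ?thesis using tpos t assms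
        by (simp add: ennreal_rpow_def inverse_ennreal ennreal_mult'[symmetric])
    qed
  qed
  finally show ?thesis .
qed

definition ln_bound :: "real \<Rightarrow> 'a \<Rightarrow> real" where
  "ln_bound R x = enn2real (sup_ln R x) + enn2real (sup_neg_ln R x)"

lemma ln_bound_nonneg: "0 \<le> ln_bound R x"
  by (simp add: ln_bound_def)

text \<open>A finite supremum excludes a zero ratio at rational radii below \<open>R\<close>; one of
  them lies below \<open>r\<close>, and \<open>F x\<close> is monotone.\<close>

lemma F_pos_if_sup_neg_ln_finite:
  assumes "sup_neg_ln R x < \<infinity>" "0 < R" "0 < r"
  shows "0 < F x r"
proof -
  obtain s where s: "s \<in> \<rat>" "0 < s" "s < min r R"
    using Rats_dense_in_real[of 0 "min r R"] assms by auto
  have "(if ratio x s = 0 then \<infinity> else ennreal (- ln (ratio x s))) \<le> sup_neg_ln R x"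
    unfolding sup_neg_ln_def using s by (intro SUP_upper) auto
  then have "ratio x s \<noteq> 0" using assms by (auto simp: top_unique split: if_splits)
  then have "0 < F x s" using F_nonneg[of x s] by (auto simp: ratio_def)
  also have "\<dots> \<le> F x r" using s by (intro F_mono) auto
  finally show ?thesis .
qed

text \<open>Extends the bound from rational to all radii by continuity of \<open>F x\<close>. The
  limit is taken from the left, so the rational radius stays below \<open>R\<close> even for
  \<open>r = R\<close>.\<close>

lemma abs_ln_ratio_le_small:
  assumes fin: "sup_ln R x < \<infinity>" "sup_neg_ln R x < \<infinity>" and r: "0 < r" "r \<le> R"
  shows "\<bar>ln (ratio x r)\<bar> \<le> ln_bound R x"
proof (rule ccontr)
  assume "\<not> \<bar>ln (ratio x r)\<bar> \<le> ln_bound R x"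
  then have less: "ln_bound R x < \<bar>ln (ratio x r)\<bar>" by simp
  have pos: "0 < F x r" using F_pos_if_sup_neg_ln_finite[OF fin(2)] r by auto
  have "isCont (F x) r" using F_continuous by (simp add: continuous_on_eq_continuous_at)
  then have "isCont (\<lambda>r. \<bar>ln (F x r / (unit_ball_vol (real DIM('a)) * r ^ DIM('a)))\<bar>) r"
    using r pos unit_ball_vol_nonzero[of "DIM('a)"] by (intro continuous_intros) auto
  then have "((\<lambda>s. \<bar>ln (ratio x s)\<bar>) \<longlongrightarrow> \<bar>ln (ratio x r)\<bar>) (at_left r)"
    unfolding ratio_def ball_volume_def isCont_def
    by (rule tendsto_mono[OF at_le, rotated]) auto
  then have "\<forall>\<^sub>F s in at_left r. ln_bound R x < \<bar>ln (ratio x s)\<bar>"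
    using less by (rule order_tendstoD)
  then obtain b where b: "b < r" "\<And>s. b < s \<Longrightarrow> s < r \<Longrightarrow> ln_bound R x < \<bar>ln (ratio x s)\<bar>"
    unfolding eventually_at_left_field by blast
  obtain s where s: "s \<in> \<rat>" "max b 0 < s" "s < r"
    using Rats_dense_in_real[of "max b 0" r] b r by auto
  have "ennreal (ln (ratio x s)) \<le> sup_ln R x"
    unfolding sup_ln_def using s r by (intro SUP_upper) auto
  then have "ennreal (ln (ratio x s)) \<le> ennreal (enn2real (sup_ln R x))" using fin by simp
  then have 1: "ln (ratio x s) \<le> enn2real (sup_ln R x)" by (subst (asm) ennreal_le_iff) auto
  have "(if ratio x s = 0 then \<infinity> else ennreal (- ln (ratio x s))) \<le> sup_neg_ln R x"
    unfolding sup_neg_ln_def using s r by (intro SUP_upper) auto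
  then have "ennreal (- ln (ratio x s)) \<le> ennreal (enn2real (sup_neg_ln R x))"
    using fin by (auto simp: top_unique split: if_splits)
  then have 2: "- ln (ratio x s) \<le> enn2real (sup_neg_ln R x)" by (subst (asm) ennreal_le_iff) auto
  have "\<bar>ln (ratio x s)\<bar> \<le> ln_bound R x"
    using 1 2 enn2real_nonneg[of "sup_ln R x"] enn2real_nonneg[of "sup_neg_ln R x"]
    unfolding ln_bound_def by linarith
  then show False using b(2)[of s] s by auto
qed

text \<open>For \<open>r > R\<close> the mass is squeezed between \<open>F x R\<close> and 1, so
  \<open>ln (ratio x r)\<close> changes from its value at \<open>R\<close> by at most the
  logarithmic growth of the volume.\<close>

lemma abs_ln_ratio_le:
  assumes fin: "sup_ln R x < \<infinity>" "sup_neg_ln R x < \<infinity>" and r: "0 < r" and R: "0 < R"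
  shows "\<bar>ln (ratio x r)\<bar> \<le> ln_bound R x + ln_ratio_const DIM('a) R + real DIM('a) * ln (max 1 r)"
proof (cases "r \<le> R")
  case True
  have "0 \<le> real DIM('a) * ln (max 1 r)" by simp
  moreover have "0 \<le> ln_ratio_const DIM('a) R" by (simp add: ln_ratio_const_def)
  ultimately show ?thesis using abs_ln_ratio_le_small[OF fin r True] by linarith
next
  case False
  let ?v = "ball_volume DIM('a)"
  have pos: "0 < F x r" "0 < F x R" using F_pos_if_sup_neg_ln_finite[OF fin(2) R] r R by auto
  have v: "0 < ?v r" "0 < ?v R" using r R by (auto intro: ball_volume_pos)
  have vr: "ln (?v r) = ln (?v R) + real DIM('a) * (ln r - ln R)"
    unfolding ball_volume_def using r R unit_ball_vol_nonzero[of "DIM('a)"]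
    by (simp add: ln_mult ln_realpow algebra_simps)
  have "ln (F x r) \<le> 0" using pos F_le_1[of x r] by simp
  moreover have "ln (F x R) \<le> ln (F x r)" using pos F_mono[of R r x] False by simp
  moreover have "ln (ratio x r) = ln (F x r) - ln (?v r)" "ln (ratio x R) = ln (F x R) - ln (?v R)"
    using pos v by (auto simp: ratio_def ln_div)
  moreover have "\<bar>ln (ratio x R)\<bar> \<le> ln_bound R x" using R by (intro abs_ln_ratio_le_small[OF fin]) auto
  moreover have "0 \<le> real DIM('a) * (ln r - ln R)" using False r R by simp
  moreover have "real DIM('a) * ln r \<le> real DIM('a) * ln (max 1 r)"
    using r by (intro mult_left_mono) auto
  moreover have "0 \<le> real DIM('a) * ln (max 1 r)" by simp
  moreover have "real DIM('a) * (ln r - ln R) = real DIM('a) * ln r - real DIM('a) * ln R"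
    by (simp add: algebra_simps)
  moreover have "\<bar>real DIM('a) * ln R\<bar> = real DIM('a) * \<bar>ln R\<bar>" by (simp add: abs_mult)
  ultimately show ?thesis
    using vr ln_bound_nonneg[of R x] unfolding ln_ratio_const_def by linarith
qed

text \<open>The ratios stay above \<open>exp (- ln_bound R x)\<close>, hence so does their limit
  \<open>q x\<close>, and \<open>ln\<close> is continuous there.\<close>

lemma density_pos_and_ln_tendsto:
  assumes fin: "sup_ln R x < \<infinity>" "sup_neg_ln R x < \<infinity>" and R: "0 < R"
    and lim: "((\<lambda>r. F x r / ball_volume DIM('a) r) \<longlongrightarrow> q x) (at_right 0)"
  shows "0 < q x" "((\<lambda>r. ln (ratio x r)) \<longlongrightarrow> ln (q x)) (at_right 0)"
proof -
  have lim': "((\<lambda>r. ratio x r) \<longlongrightarrow> q x) (at_right 0)" using lim by (simp add: ratio_def)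
  have "\<forall>\<^sub>F r in at_right 0. exp (- ln_bound R x) \<le> ratio x r"
  proof (rule eventually_at_rightI[of 0 R])
    fix r assume r: "r \<in> {0<..<R}"
    then have "0 < F x r" using F_pos_if_sup_neg_ln_finite[OF fin(2)] by auto
    then have "0 < ratio x r" unfolding ratio_def using r ball_volume_pos by auto
    moreover have "- ln_bound R x \<le> ln (ratio x r)"
      using abs_ln_ratio_le_small[OF fin, of r] r by auto
    ultimately show "exp (- ln_bound R x) \<le> ratio x r" by (metis exp_le_cancel_iff exp_ln)
  qed (use R in auto)
  then have "exp (- ln_bound R x) \<le> q x"
    using lim' by (intro tendsto_lowerbound) auto
  then show "0 < q x" using exp_gt_zero less_le_trans by blast
  then show "((\<lambda>r. ln (ratio x r)) \<longlongrightarrow> ln (q x)) (at_right 0)"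
    using lim' by (intro tendsto_ln) auto
qed

end

section \<open>Iterated exponentials and integrability from the three functionals\<close>

lemma exp_iter_pos: "0 < exp_iter N"
  by (cases N) auto

text \<open>Each logarithm removes one exponential: after \<open>j\<close> of them the value still
  exceeds \<open>exp_iter (N - j)\<close>, and \<open>exp_iter 0 = 1\<close>.\<close>

lemma log_iter_gt_1: "exp_iter N < t \<Longrightarrow> 1 < log_iter N t"
proof -
  assume t: "exp_iter N < t"
  have "exp_iter (N - j) < log_iter j t" if "j \<le> N" for j
    using that
  proof (induction j)
    case (Suc j)
    then have *: "exp_iter (Suc (N - Suc j)) < log_iter j t" by (simp add: Suc_diff_Suc)
    then have "0 < log_iter j t" using exp_iter_pos order_less_trans by blast
    then show ?case using * by (metis exp_iter.simps(2) exp_less_cancel_iff exp_ln log_iter.simps(2))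
  qed (use t in simp)
  from this[of N] show ?thesis by simp
qed

lemma exp_iter_mono: "exp_iter N \<le> exp_iter (Suc N)"
proof (induction N)
  case (Suc N)
  then show ?case by simp
qed simp

text \<open>Above \<open>exp_iter N\<close>, one level beyond the cutoff of \<open>G_fun\<close>,
  the iterated logarithm exceeds 1.\<close>

lemma le_G_fun: "1 \<le> N \<Longrightarrow> exp_iter N < t \<Longrightarrow> t \<le> G_fun N t"
proof -
  assume N: "1 \<le> N" and t: "exp_iter N < t"
  have "exp_iter (N - 1) \<le> exp_iter N" using N exp_iter_mono[of "N - 1"] by simp
  then have "\<not> t \<le> exp_iter (N - 1)" using t by simp
  moreover have "1 < log_iter N t" using log_iter_gt_1[OF t] .
  moreover have "0 < t" using t exp_iter_pos[of N] by linarith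
  ultimately show ?thesis by (simp add: G_fun_def)
qed

text \<open>\<open>q\<close> is the density of the points among which neighbors are sought,
  \<open>p\<close> that of the query point. Unprefixed notions belong to \<open>q\<close>; taking
  \<open>q = p\<close> covers distances within the first sample.\<close>

locale density_pair = prob_density q + p: prob_density p for q p :: "'a::euclidean_space \<Rightarrow> real"
begin

abbreviation "P \<equiv> p.Q"

lemma nn_integral_P: "f \<in> borel_measurable borel \<Longrightarrow> (\<integral>\<^sup>+x. f x \<partial>P) = (\<integral>\<^sup>+x. f x * ennreal (p x) \<partial>lborel)"
  by (simp add: p.Q_def nn_integral_density mult.commute)

lemma nn_integral_sup_ln_finite:
  assumes "Q_fun p q \<epsilon> R < \<infinity>" "0 < \<epsilon>" "R' \<le> R"
  shows "(\<integral>\<^sup>+x. sup_ln R' x \<partial>P) < \<infinity>"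
proof -
  have "ennreal \<epsilon> * (\<integral>\<^sup>+x. sup_ln R' x \<partial>P) = (\<integral>\<^sup>+x. ennreal \<epsilon> * sup_ln R' x * ennreal (p x) \<partial>lborel)"
    by (simp add: nn_integral_P nn_integral_cmult mult.assoc)
  \<comment> \<open>Monotonicity of the nonnegative integral asks for no measurability of the larger
    integrand; the minorant built from \<open>sup_ln\<close> is measurable.\<close>
  also have "\<dots> \<le> Q_fun p q \<epsilon> R"
    unfolding Q_fun_def using sup_ln_le_rpow[OF assms(2), of R] sup_ln_mono[OF assms(3)]
    by (intro nn_integral_mono mult_right_mono) (blast intro: order_trans mult_left_mono zero_le)+
  finally have "ennreal \<epsilon> * (\<integral>\<^sup>+x. sup_ln R' x \<partial>P) < \<infinity>" using assms by (auto intro: le_less_trans)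
  then show ?thesis using assms by (auto simp: ennreal_mult_less_top)
qed

lemma nn_integral_sup_neg_ln_finite:
  assumes "T_fun p q \<epsilon> R < \<infinity>" "0 < \<epsilon>" "R' \<le> R"
  shows "(\<integral>\<^sup>+x. sup_neg_ln R' x \<partial>P) < \<infinity>"
proof -
  have "ennreal \<epsilon> * (\<integral>\<^sup>+x. sup_neg_ln R' x \<partial>P) = (\<integral>\<^sup>+x. ennreal \<epsilon> * sup_neg_ln R' x * ennreal (p x) \<partial>lborel)"
    by (simp add: nn_integral_P nn_integral_cmult mult.assoc)
  also have "\<dots> \<le> T_fun p q \<epsilon> R"
    unfolding T_fun_def using sup_neg_ln_le_rpow[OF assms(2), of R] sup_neg_ln_mono[OF assms(3)]
    by (intro nn_integral_mono mult_right_mono) (blast intro: order_trans mult_left_mono zero_le)+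
  finally have "ennreal \<epsilon> * (\<integral>\<^sup>+x. sup_neg_ln R' x \<partial>P) < \<infinity>" using assms by (auto intro: le_less_trans)
  then show ?thesis using assms by (auto simp: ennreal_mult_less_top)
qed

text \<open>Split at distance \<open>exp_iter (Suc N)\<close>: below it the logarithm is at most
  \<open>exp_iter N\<close>, above it the logarithm exceeds \<open>exp_iter N\<close> and is
  dominated by its image under \<open>G_fun N\<close>.\<close>

lemma nn_integral_ln_dist_finite:
  assumes K: "K_fun p q 1 N < \<infinity>" and N: "1 \<le> N"
  shows "(\<integral>\<^sup>+x. (\<integral>\<^sup>+y. ennreal (ln (max 1 (norm (x - y)))) \<partial>Q) \<partial>P) < \<infinity>"
proof -
  define f where "f = (\<lambda>x y :: 'a. if exp_iter (Suc N) < norm (x - y) then ennreal (ln (norm (x - y))) else 0)"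
  have f_meas [measurable]: "(\<lambda>(x, y). f x y) \<in> borel_measurable (borel \<Otimes>\<^sub>M borel)"
    unfolding f_def by measurable
  have f_meas' [measurable]: "f x \<in> borel_measurable borel" for x
    unfolding f_def by measurable
  have f_int: "(\<lambda>x. \<integral>\<^sup>+y. f x y \<partial>Q) \<in> borel_measurable borel"
    using f_meas by (intro Q.borel_measurable_nn_integral) (simp cong: measurable_cong_sets)
  have bound: "ennreal (ln (max 1 (norm (x - y)))) \<le> ennreal (exp_iter N) + f x y" for x y
  proof (cases "exp_iter (Suc N) < norm (x - y)")
    case True
    have "1 < exp_iter (Suc N)" using exp_iter_pos[of N] by simp
    then show ?thesis using True by (auto simp: f_def max_def)
  next
    case False
    have "max 1 (norm (x - y)) \<le> exp_iter (Suc N)" using False exp_iter_pos[of N] by auto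
    then have "ln (max 1 (norm (x - y))) \<le> ln (exp_iter (Suc N))"
      by (subst ln_le_cancel_iff) (auto simp: max_def)
    then show ?thesis using False by (simp add: f_def ennreal_leI)
  qed
  have claim: "f x y * ennreal (q y) * ennreal (p x) \<le>
      (case (x, y) of (x, y) \<Rightarrow> ennreal (G_fun N (\<bar>ln (norm (x - y))\<bar> powr 1) * p x * q y)) *
        indicator {(x, y). exp_iter N < norm (x - y)} (x, y)" for x y
  proof (cases "exp_iter (Suc N) < norm (x - y)")
    case True
    have 1: "exp_iter N < norm (x - y)" using True exp_iter_mono[of N] by linarith
    have pos: "0 < norm (x - y)" using 1 exp_iter_pos[of N] by linarith
    have 2: "exp_iter N < ln (norm (x - y))" using True pos by (metis exp_iter.simps(2) exp_less_cancel_iff exp_ln)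
    have 3: "0 < ln (norm (x - y))" using 2 exp_iter_pos[of N] by linarith
    have "ln (norm (x - y)) \<le> G_fun N (ln (norm (x - y)))" using N 2 by (rule le_G_fun)
    then have "(q y * p x) * ln (norm (x - y)) \<le> (q y * p x) * G_fun N (ln (norm (x - y)))"
      using density_nonneg[of y] p.density_nonneg[of x] by (intro mult_left_mono) auto
    then have "ln (norm (x - y)) * q y * p x \<le> G_fun N (ln (norm (x - y))) * p x * q y"
      by (simp add: mult_ac)
    then have "ennreal (ln (norm (x - y)) * q y * p x) \<le> ennreal (G_fun N (ln (norm (x - y))) * p x * q y)"
      by (rule ennreal_leI)
    then show ?thesis using True 1 3 density_nonneg[of y] p.density_nonneg[of x]
      by (simp add: f_def ennreal_mult)
  qed (simp add: f_def)
  have "(\<integral>\<^sup>+x. (\<integral>\<^sup>+y. f x y \<partial>Q) \<partial>P) =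
      (\<integral>\<^sup>+x. (\<integral>\<^sup>+y. f x y * ennreal (q y) \<partial>lborel) * ennreal (p x) \<partial>lborel)"
    using f_int by (simp add: nn_integral_P) (simp add: Q_def nn_integral_density mult.commute)
  also have "\<dots> = (\<integral>\<^sup>+x. (\<integral>\<^sup>+y. f x y * ennreal (q y) * ennreal (p x) \<partial>lborel) \<partial>lborel)"
    by (simp add: nn_integral_multc)
  also have "\<dots> = (\<integral>\<^sup>+(x, y). f x y * ennreal (q y) * ennreal (p x) \<partial>(lborel \<Otimes>\<^sub>M lborel))"
    by (subst lborel.nn_integral_fst[symmetric]) auto
  also have "\<dots> \<le> K_fun p q 1 N"
    unfolding K_fun_def using claim by (intro nn_integral_mono) (simp only: split_paired_all split_conv)
  finally have fin: "(\<integral>\<^sup>+x. (\<integral>\<^sup>+y. f x y \<partial>Q) \<partial>P) < \<infinity>" using K by (rule le_less_trans)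
  have "(\<integral>\<^sup>+x. (\<integral>\<^sup>+y. ennreal (ln (max 1 (norm (x - y)))) \<partial>Q) \<partial>P)
      \<le> (\<integral>\<^sup>+x. (\<integral>\<^sup>+y. ennreal (exp_iter N) + f x y \<partial>Q) \<partial>P)"
    by (intro nn_integral_mono bound)
  also have "\<dots> = (\<integral>\<^sup>+x. ennreal (exp_iter N) + (\<integral>\<^sup>+y. f x y \<partial>Q) \<partial>P)"
    by (subst nn_integral_add) (auto simp: Q.emeasure_space_1[simplified])
  also have "\<dots> = ennreal (exp_iter N) + (\<integral>\<^sup>+x. (\<integral>\<^sup>+y. f x y \<partial>Q) \<partial>P)"
    using f_int by (subst nn_integral_add) (auto simp: p.Q.emeasure_space_1[simplified] cong: measurable_cong_sets)
  also have "\<dots> < \<infinity>" using fin by simp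
  finally show ?thesis .
qed

end

subsection \<open>Convergence of the mean logarithmic distance\<close>

text \<open>Missing \<open>A\<close> at \<open>k\<close> consecutive indices has probability
  \<open>(1 - measure Q A) ^ k\<close>, which tends to 0; so missing it from some index on is a null
  event.\<close>

lemma AE_PiM_infinitely_often:
  assumes "prob_space Q" and A [measurable]: "A \<in> sets Q" and pos: "0 < measure Q A"
  shows "AE y in PiM UNIV (\<lambda>_::nat. Q). infinite {j. y j \<in> A}"
proof -
  interpret Q: prob_space Q by fact
  interpret S: product_prob_space "\<lambda>_::nat. Q" UNIV ..
  let ?S = "PiM UNIV (\<lambda>_::nat. Q)"
  have "AE y in ?S. \<exists>j\<ge>n. y j \<in> A" for n
  proof -
    define B where "B = {y\<in>space ?S. \<forall>j\<ge>n. y j \<notin> A}"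
    have [measurable]: "B \<in> sets ?S" unfolding B_def by measurable
    have "measure ?S B \<le> (1 - measure Q A) ^ k" for k
    proof -
      have "emeasure ?S B \<le> emeasure ?S {y\<in>space ?S. \<forall>j\<in>{n..<n+k}. y j \<in> space Q - A}"
      proof (rule emeasure_mono)
        have "{y\<in>space ?S. \<forall>j\<in>{n..<n+k}. y j \<in> space Q - A} = {y\<in>space ?S. \<forall>j\<in>{n..<n+k}. y j \<notin> A}"
          by (auto simp: space_PiM)
        also have "\<dots> \<in> sets ?S" by measurable
        finally show "{y\<in>space ?S. \<forall>j\<in>{n..<n+k}. y j \<in> space Q - A} \<in> sets ?S" .
      qed (auto simp: B_def space_PiM)
      also have "\<dots> = (\<Prod>j\<in>{n..<n+k}. emeasure Q (space Q - A))"
        by (rule S.emeasure_PiM_Collect) auto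
      also have "\<dots> = ennreal ((1 - measure Q A) ^ k)"
        by (simp add: Q.emeasure_eq_measure Q.prob_compl ennreal_power)
      finally show ?thesis by (simp add: S.emeasure_eq_measure)
    qed
    moreover have "(\<lambda>k. (1 - measure Q A) ^ k) \<longlonglongrightarrow> 0"
      using pos Q.prob_le_1[of A] by (intro LIMSEQ_power_zero) auto
    ultimately have "measure ?S B \<le> 0" by (intro LIMSEQ_le_const) auto
    then have "B \<in> null_sets ?S" by (auto simp: null_sets_def S.emeasure_eq_measure measure_le_0_iff)
    then show ?thesis by (rule AE_I') (auto simp: B_def)
  qed
  then have "AE y in ?S. \<forall>n. \<exists>j\<ge>n. y j \<in> A" by (simp add: AE_all_countable)
  then show ?thesis
    by eventually_elim (auto simp: infinite_nat_iff_unbounded_le)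
qed

context prob_density
begin

lemma AE_nn_dist_tendsto_0:
  assumes "\<And>r. 0 < r \<Longrightarrow> 0 < F x r" "1 \<le> l"
  shows "AE y in samples. (\<lambda>m. nn_dist l x y {..<m}) \<longlonglongrightarrow> 0"
proof -
  have "AE y in samples. \<forall>n. infinite {j. norm (x - y j) \<le> 1 / Suc n}"
    unfolding AE_all_countable
  proof
    fix n
    have "AE y in samples. infinite {j. y j \<in> cball x (1 / Suc n)}"
      using assms(1) by (intro AE_PiM_infinitely_often Q.prob_space_axioms) (auto simp flip: F_def)
    then show "AE y in samples. infinite {j. norm (x - y j) \<le> 1 / Suc n}" by (simp add: dist_norm)
  qed
  then show ?thesis
  proof eventually_elim
    fix y :: "nat \<Rightarrow> 'a" assume y: "\<forall>n. infinite {j. norm (x - y j) \<le> 1 / Suc n}"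
    show "(\<lambda>m. nn_dist l x y {..<m}) \<longlonglongrightarrow> 0"
    proof (rule nn_dist_tendsto_0[OF assms(2)])
      fix e :: real assume "0 < e"
      then obtain n where "1 / Suc n < e" using nat_approx_posE by blast
      then have "{j. norm (x - y j) \<le> 1 / Suc n} \<subseteq> {j. norm (x - y j) \<le> e}" by auto
      then show "infinite {j. norm (x - y j) \<le> e}" using y infinite_super by blast
    qed
  qed
qed

end

section \<open>A query point together with an infinite independent sample\<close>

context density_pair
begin

text \<open>The canonical model: a single space carries the distances for all \<open>m\<close>, as
  dominated convergence in \<open>m\<close> requires.\<close>

abbreviation "query_samples \<equiv> P \<Otimes>\<^sub>M samples"

lemma prob_space_query_samples: "prob_space query_samples"
proof -
  interpret S: prob_space samples by (rule prob_space_samples)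
  interpret pair_prob_space P samples ..
  show ?thesis by (rule prob_space_axioms)
qed

lemma distr_query: "distr query_samples P fst = P"
proof -
  interpret S: prob_space samples by (rule prob_space_samples)
  show ?thesis by (rule S.distr_pair_fst)
qed

lemma AE_query: "AE x in P. \<phi> x \<Longrightarrow> AE z in query_samples. \<phi> (fst z)"
proof -
  assume "AE x in P. \<phi> x"
  then have "AE x in distr query_samples P fst. \<phi> x" by (simp only: distr_query)
  then show ?thesis by (rule AE_distrD[rotated]) simp
qed

lemma AE_query_samples:
  assumes "AE x in P. AE y in samples. \<phi> (x, y)" "{z\<in>space query_samples. \<phi> z} \<in> sets query_samples"
  shows "AE z in query_samples. \<phi> z"
proof -
  interpret S: prob_space samples by (rule prob_space_samples)
  interpret pair_prob_space P samples ..
  show ?thesis using assms(2,1) by (rule AE_pair_measure)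
qed

lemma integrable_query:
  fixes g :: "'a \<Rightarrow> real"
  assumes "integrable P g"
  shows "integrable query_samples (\<lambda>z. g (fst z))" "(\<integral>z. g (fst z) \<partial>query_samples) = (\<integral>x. g x \<partial>P)"
proof -
  have "g \<in> borel_measurable P" using assms by auto
  then show "integrable query_samples (\<lambda>z. g (fst z))" "(\<integral>z. g (fst z) \<partial>query_samples) = (\<integral>x. g x \<partial>P)"
    using assms integrable_distr_eq[of fst query_samples P g] integral_distr[of fst query_samples P g]
    by (auto simp: distr_query)
qed

lemma measurable_nn_dist_query:
  assumes "1 \<le> l" "l \<le> m"
  shows "(\<lambda>z. nn_dist l (fst z) (snd z) {..<m}) \<in> borel_measurable query_samples"
  by (rule measurable_nn_dist[OF assms]) measurable

end

text \<open>The sum is the harmonic number of \<open>m\<close> minus that of \<open>l - 1\<close>;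
  the former minus \<open>ln m\<close> tends to Euler's constant, and \<open>Digamma l\<close> is
  the latter minus this constant.\<close>

lemma ln_minus_harmonic_tendsto_Digamma:
  assumes "1 \<le> l"
  shows "(\<lambda>m. ln (real m) - (\<Sum>i=l..m. 1 / real i)) \<longlonglongrightarrow> Digamma (real l)"
proof -
  obtain l' where l': "l = Suc l'" using assms by (cases l) auto
  have "(\<lambda>m. harm l' - (harm m - ln (real m))) \<longlonglongrightarrow> harm l' - (euler_mascheroni :: real)"
    by (intro tendsto_intros euler_mascheroni_LIMSEQ)
  moreover have "Digamma (real l) = harm l' - euler_mascheroni"
    unfolding l' by (rule Digamma_of_nat)
  moreover have "\<forall>\<^sub>F m in sequentially. harm l' - (harm m - ln (real m)) = ln (real m) - (\<Sum>i=l..m. 1 / real i)"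
    using eventually_ge_at_top[of l]
  proof eventually_elim
    fix m assume "l \<le> m"
    then have "{1..m} = {1..l'} \<union> {l..m}" "{1..l'} \<inter> {l..m} = {}" using l' by auto
    then have "harm m = harm l' + (\<Sum>i=l..m. 1 / real i)"
      unfolding harm_def by (simp add: sum.union_disjoint inverse_eq_divide)
    then show "harm l' - (harm m - ln (real m)) = ln (real m) - (\<Sum>i=l..m. 1 / real i)" by simp
  qed
  ultimately show ?thesis by (simp add: Lim_transform_eventually)
qed

text \<open>Condenses the three functionals into integrability facts with one common radius. It is
  used twice, for the neighbor densities \<open>q\<close> and \<open>p\<close>.\<close>

locale regular_density_pair = density_pair +
  fixes R :: real
  assumes R_pos: "0 < R"
    and sup_ln_integrable: "(\<integral>\<^sup>+x. sup_ln R x \<partial>P) < \<infinity>"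
    and sup_neg_ln_integrable: "(\<integral>\<^sup>+x. sup_neg_ln R x \<partial>P) < \<infinity>"
    and ln_dist_integrable: "(\<integral>\<^sup>+x. (\<integral>\<^sup>+y. ennreal (ln (max 1 (norm (x - y)))) \<partial>Q) \<partial>P) < \<infinity>"
begin

definition regular_point :: "'a \<Rightarrow> bool" where
  "regular_point x \<longleftrightarrow> sup_ln R x < \<infinity> \<and> sup_neg_ln R x < \<infinity> \<and>
     ((\<lambda>r. F x r / ball_volume DIM('a) r) \<longlongrightarrow> q x) (at_right 0)"

lemma AE_regular_point: "AE x in P. regular_point x"
proof -
  have "AE x in P. sup_ln R x \<noteq> \<infinity>"
    by (rule nn_integral_PInf_AE) (use sup_ln_integrable in auto)
  moreover have "AE x in P. sup_neg_ln R x \<noteq> \<infinity>"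
    by (rule nn_integral_PInf_AE) (use sup_neg_ln_integrable in auto)
  moreover have "AE x in P. ((\<lambda>r. F x r / ball_volume DIM('a) r) \<longlongrightarrow> q x) (at_right 0)"
    unfolding p.Q_def using Lebesgue_differentiation by (subst AE_density) auto
  ultimately show ?thesis
    by eventually_elim (auto simp: regular_point_def less_top)
qed

lemma AE_density_pos: "AE x in P. 0 < q x"
  using AE_regular_point
  by eventually_elim (auto simp: regular_point_def intro: density_pos_and_ln_tendsto(1)[OF _ _ R_pos])

lemma regular_point_F_pos: "regular_point x \<Longrightarrow> 0 < r \<Longrightarrow> 0 < F x r"
  unfolding regular_point_def using F_pos_if_sup_neg_ln_finite[OF _ R_pos] by auto

lemma AE_query_nn_dist_pos:
  assumes "1 \<le> l" "l \<le> m"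
  shows "AE z in query_samples. 0 < nn_dist l (fst z) (snd z) {..<m}"
proof (rule AE_query_samples)
  have "AE y in samples. 0 < nn_dist l x y {..<m}" for x
    using AE_sample_neq[of x]
  proof eventually_elim
    fix y :: "nat \<Rightarrow> 'a" assume y: "\<forall>j. y j \<noteq> x"
    show "0 < nn_dist l x y {..<m}"
      using nn_dist_attained[of "{..<m}" l x y] assms y by auto
  qed
  then show "AE x in P. AE y in samples. 0 < nn_dist l (fst (x, y)) (snd (x, y)) {..<m}" by simp
  show "{z \<in> space query_samples. 0 < nn_dist l (fst z) (snd z) {..<m}} \<in> sets query_samples"
    using measurable_nn_dist_query[OF assms] by measurable
qed

lemma AE_query_nn_dist_tendsto_0:
  assumes l: "1 \<le> l"
  shows "AE z in query_samples. (\<lambda>m. nn_dist l (fst z) (snd z) {..<m}) \<longlonglongrightarrow> 0"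
proof -
  \<comment> \<open>Measurability of the distance is available only for \<open>m \<ge> l\<close>,
    hence the shift by \<open>l\<close>, undone at the end.\<close>
  have "AE z in query_samples. (\<lambda>m. nn_dist l (fst z) (snd z) {..<m + l}) \<longlonglongrightarrow> 0"
  proof (rule AE_query_samples)
    have "AE x in P. AE y in samples. (\<lambda>m. nn_dist l x y {..<m}) \<longlonglongrightarrow> 0"
      using AE_regular_point
      by eventually_elim (intro AE_nn_dist_tendsto_0 regular_point_F_pos l)
    then show "AE x in P. AE y in samples.
        (\<lambda>m. nn_dist l (fst (x, y)) (snd (x, y)) {..<m + l}) \<longlonglongrightarrow> 0"
      by (rule eventually_mono) (auto elim!: eventually_mono intro: LIMSEQ_ignore_initial_segment)
    have [measurable]: "(\<lambda>z. nn_dist l (fst z) (snd z) {..<m + l}) \<in> borel_measurable query_samples" for m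
      using l by (intro measurable_nn_dist_query) auto
    show "{z \<in> space query_samples. (\<lambda>m. nn_dist l (fst z) (snd z) {..<m + l}) \<longlonglongrightarrow> 0} \<in> sets query_samples"
      by measurable
  qed
  then show ?thesis by eventually_elim (rule LIMSEQ_offset)
qed

text \<open>Majorant of the absolute logarithmic ratio, valid for every \<open>m \<ge> l\<close>
  simultaneously.\<close>

definition dominator :: "nat \<Rightarrow> 'a \<times> (nat \<Rightarrow> 'a) \<Rightarrow> real" where
  "dominator l z = ln_bound R (fst z) + ln_ratio_const DIM('a) R
     + real DIM('a) * (\<Sum>j<l. ln (max 1 (norm (fst z - snd z j))))"

lemma integrable_ln_bound: "integrable P (ln_bound R)"
proof -
  \<comment> \<open>\<open>enn2real\<close> maps infinity to 0, so the truncated function lies below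
    \<open>f\<close> everywhere.\<close>
  have *: "integrable P (\<lambda>x. enn2real (f x))" if [measurable]: "f \<in> borel_measurable borel" and "(\<integral>\<^sup>+x. f x \<partial>P) < \<infinity>" for f
  proof (rule integrableI_nonneg)
    have "(\<integral>\<^sup>+x. ennreal (enn2real (f x)) \<partial>P) \<le> (\<integral>\<^sup>+x. f x \<partial>P)"
      by (intro nn_integral_mono) (simp add: ennreal_enn2real_if)
    then show "(\<integral>\<^sup>+x. ennreal (enn2real (f x)) \<partial>P) < \<infinity>" using that by (auto intro: le_less_trans)
  qed auto
  show ?thesis unfolding ln_bound_def
    using sup_ln_integrable sup_neg_ln_integrable by (intro Bochner_Integration.integrable_add *) auto
qed

lemma integrable_ln_dist: "integrable query_samples (\<lambda>z. ln (max 1 (norm (fst z - snd z j))))"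
proof (rule integrableI_nonneg)
  interpret S: prob_space samples by (rule prob_space_samples)
  show [measurable]: "(\<lambda>z. ln (max 1 (norm (fst z - snd z j)))) \<in> borel_measurable query_samples" by measurable
  have "(\<integral>\<^sup>+z. ennreal (ln (max 1 (norm (fst z - snd z j)))) \<partial>query_samples)
      = (\<integral>\<^sup>+x. (\<integral>\<^sup>+y. ennreal (ln (max 1 (norm (x - y j)))) \<partial>samples) \<partial>P)"
    by (subst S.nn_integral_fst[symmetric]) auto
  also have "\<dots> = (\<integral>\<^sup>+x. (\<integral>\<^sup>+y. ennreal (ln (max 1 (norm (x - y)))) \<partial>distr samples Q (\<lambda>y. y j)) \<partial>P)"
    by (subst nn_integral_distr) auto
  also have "distr samples Q (\<lambda>y. y j) = Q"
    by (intro distr_PiM_component) (auto intro: Q.prob_space_axioms)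
  finally show "(\<integral>\<^sup>+z. ennreal (ln (max 1 (norm (fst z - snd z j)))) \<partial>query_samples) < \<infinity>"
    using ln_dist_integrable by simp
qed auto

lemma integrable_dominator: "integrable query_samples (dominator l)"
proof -
  interpret C: prob_space query_samples by (rule prob_space_query_samples)
  show ?thesis
    unfolding dominator_def
    by (intro Bochner_Integration.integrable_add integrable_query integrable_ln_bound C.integrable_const
        integrable_mult_right Bochner_Integration.integrable_sum integrable_ln_dist)
qed

lemma measurable_ln_ratio:
  assumes "1 \<le> l" "l \<le> m"
  shows "(\<lambda>z. ln (ratio (fst z) (nn_dist l (fst z) (snd z) {..<m}))) \<in> borel_measurable query_samples"
proof -
  note [measurable] = measurable_nn_dist_query[OF assms]
  have [measurable]: "fst \<in> borel_measurable query_samples" by measurable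
  have "(\<lambda>z. ratio (fst z) (nn_dist l (fst z) (snd z) {..<m})) \<in> borel_measurable query_samples"
    by (rule ratio_measurable) fact+
  then show ?thesis by simp
qed

lemma AE_ln_ratio_le_dominator:
  assumes lm: "1 \<le> l" "l \<le> m"
  shows "AE z in query_samples. norm (ln (ratio (fst z) (nn_dist l (fst z) (snd z) {..<m}))) \<le> dominator l z"
  using AE_query[OF AE_regular_point] AE_query_nn_dist_pos[OF lm]
proof eventually_elim
  fix z assume x: "regular_point (fst z)" and pos: "0 < nn_dist l (fst z) (snd z) {..<m}"
  let ?\<rho> = "nn_dist l (fst z) (snd z) {..<m}"
  have "\<bar>ln (ratio (fst z) ?\<rho>)\<bar> \<le> ln_bound R (fst z) + ln_ratio_const DIM('a) R + real DIM('a) * ln (max 1 ?\<rho>)"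
    using x pos R_pos by (intro abs_ln_ratio_le) (auto simp: regular_point_def)
  moreover have "ln (max 1 ?\<rho>) \<le> (\<Sum>j<l. ln (max 1 (norm (fst z - snd z j))))"
    by (rule nn_dist_le_sum[OF lm, where g="\<lambda>t. ln (max 1 t)"]) (auto simp: mono_def)
  then have "real DIM('a) * ln (max 1 ?\<rho>) \<le> real DIM('a) * (\<Sum>j<l. ln (max 1 (norm (fst z - snd z j))))"
    by (intro mult_left_mono) auto
  ultimately show "norm (ln (ratio (fst z) ?\<rho>)) \<le> dominator l z"
    unfolding dominator_def real_norm_def by linarith
qed

lemma integrable_ln_ratio:
  assumes "1 \<le> l" "l \<le> m"
  shows "integrable query_samples (\<lambda>z. ln (ratio (fst z) (nn_dist l (fst z) (snd z) {..<m})))"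
  using integrable_dominator measurable_ln_ratio[OF assms]
proof (rule Bochner_Integration.integrable_bound)
  show "AE z in query_samples. norm (ln (ratio (fst z) (nn_dist l (fst z) (snd z) {..<m}))) \<le> norm (dominator l z)"
    using AE_ln_ratio_le_dominator[OF assms] by eventually_elim (rule order_trans, assumption, simp)
qed

text \<open>Dominated convergence with \<open>dominator l\<close>. Integrability of the limit
  \<open>ln q\<close> comes along and later makes the divergence finite.\<close>

lemma ln_ratio_convergence:
  assumes l: "1 \<le> l"
  shows "integrable P (\<lambda>x. ln (q x))"
    and "(\<lambda>m. \<integral>z. ln (ratio (fst z) (nn_dist l (fst z) (snd z) {..<m})) \<partial>query_samples)
           \<longlonglongrightarrow> (\<integral>x. ln (q x) \<partial>P)"
proof -
  define f where "f = (\<lambda>m z. ln (ratio (fst z) (nn_dist l (fst z) (snd z) {..<m + l})))"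
  have f_meas: "f m \<in> borel_measurable query_samples" for m
    unfolding f_def using l by (intro measurable_ln_ratio) auto
  have q_meas: "(\<lambda>z. ln (q (fst z))) \<in> borel_measurable query_samples" by measurable
  have dom: "AE z in query_samples. norm (f m z) \<le> dominator l z" for m
    unfolding f_def using l by (intro AE_ln_ratio_le_dominator) auto
  have pos: "AE z in query_samples. \<forall>m. 0 < nn_dist l (fst z) (snd z) {..<m + l}"
    unfolding AE_all_countable using l by (intro allI AE_query_nn_dist_pos) auto
  have lim: "AE z in query_samples. (\<lambda>m. f m z) \<longlonglongrightarrow> ln (q (fst z))"
    using AE_query[OF AE_regular_point] pos AE_query_nn_dist_tendsto_0[OF l]
  proof eventually_elim
    fix z assume x: "regular_point (fst z)" and pos: "\<forall>m. 0 < nn_dist l (fst z) (snd z) {..<m + l}"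
      and lim: "(\<lambda>m. nn_dist l (fst z) (snd z) {..<m}) \<longlonglongrightarrow> 0"
    have "((\<lambda>r. ln (ratio (fst z) r)) \<longlongrightarrow> ln (q (fst z))) (at_right 0)"
      using x R_pos by (intro density_pos_and_ln_tendsto(2)) (auto simp: regular_point_def)
    \<comment> \<open>Differentiation is a limit from the right at radius 0, so positivity of the
      distances is needed besides convergence to 0.\<close>
    moreover have "filterlim (\<lambda>m. nn_dist l (fst z) (snd z) {..<m + l}) (at_right 0) sequentially"
      unfolding filterlim_at using LIMSEQ_ignore_initial_segment[OF lim, of l] pos
      by (auto intro!: always_eventually simp: less_imp_neq[THEN not_sym])
    ultimately show "(\<lambda>m. f m z) \<longlonglongrightarrow> ln (q (fst z))"
      unfolding f_def by (rule filterlim_compose)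
  qed
  note dct = q_meas f_meas integrable_dominator lim dom
  have int: "integrable query_samples (\<lambda>z. ln (q (fst z)))"
    using dct by (rule integrable_dominated_convergence)
  then show int': "integrable P (\<lambda>x. ln (q x))"
    using integrable_distr_eq[of fst query_samples P "\<lambda>x. ln (q x)"] by (simp add: distr_query)
  have "(\<lambda>m. integral\<^sup>L query_samples (f m)) \<longlonglongrightarrow> (\<integral>z. ln (q (fst z)) \<partial>query_samples)"
    using dct by (rule integral_dominated_convergence)
  also have "(\<integral>z. ln (q (fst z)) \<partial>query_samples) = (\<integral>x. ln (q x) \<partial>P)"
    using integrable_query(2)[OF int'] .
  finally show "(\<lambda>m. \<integral>z. ln (ratio (fst z) (nn_dist l (fst z) (snd z) {..<m})) \<partial>query_samples)
           \<longlonglongrightarrow> (\<integral>x. ln (q x) \<partial>P)"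
    unfolding f_def by (rule LIMSEQ_offset)
qed

text \<open>Given a regular query point the mean is a constant free of that point, so averaging over
  \<open>P\<close> leaves it unchanged.\<close>

lemma ln_F_has_integral:
  assumes lm: "1 \<le> l" "l \<le> m"
  shows "has_bochner_integral query_samples
    (\<lambda>z. - ln (F (fst z) (nn_dist l (fst z) (snd z) {..<m}))) (\<Sum>i=l..m. 1 / real i)"
proof (rule has_bochner_integral_nn_integral)
  interpret S: prob_space samples by (rule prob_space_samples)
  note [measurable] = measurable_nn_dist_query[OF lm]
  have [measurable]: "fst \<in> borel_measurable query_samples" by measurable
  have "(\<lambda>z. F (fst z) (nn_dist l (fst z) (snd z) {..<m})) \<in> borel_measurable query_samples"
    by (rule F_measurable) fact+
  then show meas [measurable]: "(\<lambda>z. - ln (F (fst z) (nn_dist l (fst z) (snd z) {..<m}))) \<in> borel_measurable query_samples"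
    by measurable
  show "AE z in query_samples. 0 \<le> - ln (F (fst z) (nn_dist l (fst z) (snd z) {..<m}))"
    using AE_query[OF AE_regular_point] AE_query_nn_dist_pos[OF lm]
  proof eventually_elim
    fix z assume "regular_point (fst z)" "0 < nn_dist l (fst z) (snd z) {..<m}"
    then have "0 < F (fst z) (nn_dist l (fst z) (snd z) {..<m})" by (rule regular_point_F_pos)
    then show "0 \<le> - ln (F (fst z) (nn_dist l (fst z) (snd z) {..<m}))"
      using F_le_1 by simp
  qed
  show "0 \<le> (\<Sum>i=l..m. 1 / real i)" by (intro sum_nonneg) auto
  have "(\<integral>\<^sup>+z. ennreal (- ln (F (fst z) (nn_dist l (fst z) (snd z) {..<m}))) \<partial>query_samples) =
      (\<integral>\<^sup>+x. (\<integral>\<^sup>+y. ennreal (- ln (F x (nn_dist l x y {..<m}))) \<partial>samples) \<partial>P)"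
    by (subst S.nn_integral_fst[symmetric]) auto
  also have "\<dots> = (\<integral>\<^sup>+x. ennreal (\<Sum>i=l..m. 1 / real i) \<partial>P)"
    using AE_regular_point
    by (intro nn_integral_cong_AE) (auto elim!: eventually_mono intro!: nn_integral_neg_ln_F_nn_dist regular_point_F_pos lm)
  also have "\<dots> = ennreal (\<Sum>i=l..m. 1 / real i)"
    by (simp add: p.Q.emeasure_space_1[simplified])
  finally show "(\<integral>\<^sup>+z. ennreal (- ln (F (fst z) (nn_dist l (fst z) (snd z) {..<m}))) \<partial>query_samples) =
    ennreal (\<Sum>i=l..m. 1 / real i)" .
qed

text \<open>Covers both halves of the estimator: the numerators with sample size \<open>m\<close>,
  the denominators with sample size \<open>n - 1\<close>.\<close>

definition mean_ln_dist :: "nat \<Rightarrow> nat \<Rightarrow> real" where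
  "mean_ln_dist l m = (\<integral>z. ln (real m * nn_dist l (fst z) (snd z) {..<m} ^ DIM('a)) \<partial>query_samples)"

text \<open>Rests on \<open>m \<rho>^d = m F / (V_d ratio)\<close>. The logarithms of
  \<open>F\<close> and of the ratio are integrable separately, so the integral may be split.\<close>

lemma mean_ln_dist_eq:
  assumes lm: "1 \<le> l" "l \<le> m"
  shows "integrable query_samples (\<lambda>z. ln (real m * nn_dist l (fst z) (snd z) {..<m} ^ DIM('a)))"
    and "mean_ln_dist l m = ln (real m) - ln (unit_ball_vol (real DIM('a))) - (\<Sum>i=l..m. 1 / real i)
       - (\<integral>z. ln (ratio (fst z) (nn_dist l (fst z) (snd z) {..<m})) \<partial>query_samples)"
proof -
  interpret C: prob_space query_samples by (rule prob_space_query_samples)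
  let ?\<rho> = "\<lambda>z. nn_dist l (fst z) (snd z) {..<m}"
  let ?c = "ln (real m) - ln (unit_ball_vol (real DIM('a)))"
  have meas: "(\<lambda>z. ln (real m * ?\<rho> z ^ DIM('a))) \<in> borel_measurable query_samples"
    using measurable_nn_dist_query[OF lm] by measurable
  have eq: "AE z in query_samples. ln (real m * ?\<rho> z ^ DIM('a)) =
      ?c - (- ln (F (fst z) (?\<rho> z))) - ln (ratio (fst z) (?\<rho> z))"
    using AE_query[OF AE_regular_point] AE_query_nn_dist_pos[OF lm]
  proof eventually_elim
    fix z assume x: "regular_point (fst z)" and pos: "0 < ?\<rho> z"
    have "0 < F (fst z) (?\<rho> z)" using x pos by (rule regular_point_F_pos)
    then show "ln (real m * ?\<rho> z ^ DIM('a)) = ?c - (- ln (F (fst z) (?\<rho> z))) - ln (ratio (fst z) (?\<rho> z))"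
      using pos lm unit_ball_vol_nonzero[of "DIM('a)"]
      by (simp add: ratio_def ball_volume_def ln_mult ln_div)
  qed
  note intF = integrable.intros[OF ln_F_has_integral[OF lm]]
  have int: "integrable query_samples (\<lambda>z. ?c - (- ln (F (fst z) (?\<rho> z))) - ln (ratio (fst z) (?\<rho> z)))"
    by (intro Bochner_Integration.integrable_diff C.integrable_const intF integrable_ln_ratio lm)
  show "integrable query_samples (\<lambda>z. ln (real m * ?\<rho> z ^ DIM('a)))"
    using int eq meas by (subst integrable_cong_AE) auto
  have "mean_ln_dist l m = (\<integral>z. ?c - (- ln (F (fst z) (?\<rho> z))) - ln (ratio (fst z) (?\<rho> z)) \<partial>query_samples)"
    unfolding mean_ln_dist_def using eq meas int by (intro integral_cong_AE) auto
  also have "\<dots> = (\<integral>z. ?c - (- ln (F (fst z) (?\<rho> z))) \<partial>query_samples)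
      - (\<integral>z. ln (ratio (fst z) (?\<rho> z)) \<partial>query_samples)"
    by (intro Bochner_Integration.integral_diff Bochner_Integration.integrable_diff C.integrable_const intF integrable_ln_ratio lm)
  also have "(\<integral>z. ?c - (- ln (F (fst z) (?\<rho> z))) \<partial>query_samples)
      = (\<integral>z. ?c \<partial>query_samples) - (\<integral>z. - ln (F (fst z) (?\<rho> z)) \<partial>query_samples)"
    by (intro Bochner_Integration.integral_diff C.integrable_const intF)
  also have "(\<integral>z. - ln (F (fst z) (?\<rho> z)) \<partial>query_samples) = (\<Sum>i=l..m. 1 / real i)"
    by (rule has_bochner_integral_integral_eq[OF ln_F_has_integral[OF lm]])
  finally show "mean_ln_dist l m = ?c - (\<Sum>i=l..m. 1 / real i)
       - (\<integral>z. ln (ratio (fst z) (?\<rho> z)) \<partial>query_samples)"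
    by (simp add: C.prob_space)
qed

lemma mean_ln_dist_tendsto:
  assumes "1 \<le> l"
  shows "(\<lambda>m. mean_ln_dist l m) \<longlonglongrightarrow>
    Digamma (real l) - ln (unit_ball_vol (real DIM('a))) - (\<integral>x. ln (q x) \<partial>P)"
proof -
  have "(\<lambda>m. (ln (real m) - (\<Sum>i=l..m. 1 / real i)) - ln (unit_ball_vol (real DIM('a)))
       - (\<integral>z. ln (ratio (fst z) (nn_dist l (fst z) (snd z) {..<m})) \<partial>query_samples)) \<longlonglongrightarrow>
    Digamma (real l) - ln (unit_ball_vol (real DIM('a))) - (\<integral>x. ln (q x) \<partial>P)"
    by (intro tendsto_diff tendsto_const ln_minus_harmonic_tendsto_Digamma ln_ratio_convergence assms)
  moreover have "\<forall>\<^sub>F m in sequentially. (ln (real m) - (\<Sum>i=l..m. 1 / real i)) - ln (unit_ball_vol (real DIM('a)))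
       - (\<integral>z. ln (ratio (fst z) (nn_dist l (fst z) (snd z) {..<m})) \<partial>query_samples) = mean_ln_dist l m"
    using eventually_ge_at_top[of l] by eventually_elim (subst mean_ln_dist_eq(2)[OF assms], simp_all)
  ultimately show ?thesis by (rule Lim_transform_eventually)
qed

end

subsection \<open>The divergence and the estimator\<close>

context density_pair
begin

text \<open>Positivity of \<open>q\<close> almost everywhere under \<open>P\<close> yields absolute
  continuity. Integrability of both logarithms makes the positive and negative parts finite, so the
  extended difference is a real one.\<close>

lemma KL_density_eq:
  assumes pos: "AE x in P. 0 < q x"
    and int: "integrable P (\<lambda>x. ln (p x))" "integrable P (\<lambda>x. ln (q x))"
  shows "KL_density p q = ereal ((\<integral>x. ln (p x) \<partial>P) - (\<integral>x. ln (q x) \<partial>P))"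
proof -
  have pos': "AE x in lborel. 0 < p x \<longrightarrow> 0 < q x"
    using pos unfolding p.Q_def by (subst (asm) AE_density) auto
  have ac: "absolutely_continuous (density lborel (\<lambda>x. ennreal (q x))) (density lborel (\<lambda>x. ennreal (p x)))"
    unfolding absolutely_continuous_def
  proof
    fix A assume "A \<in> null_sets (density lborel (\<lambda>x. ennreal (q x)))"
    then have A: "A \<in> sets lborel" "AE x in lborel. x \<in> A \<longrightarrow> ennreal (q x) = 0"
      by (simp_all add: null_sets_density_iff)
    have "AE x in lborel. x \<in> A \<longrightarrow> ennreal (p x) = 0"
      using A(2) pos' by eventually_elim (auto simp: ennreal_eq_0_iff not_less)
    then show "A \<in> null_sets (density lborel (\<lambda>x. ennreal (p x)))"
      using A by (simp add: null_sets_density_iff)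
  qed
  let ?f = "\<lambda>x. p x * ln (p x / q x)"
  have ppos: "AE x in P. 0 < p x"
    unfolding p.Q_def by (subst AE_density) auto
  have eq: "AE x in P. ln (p x / q x) = ln (p x) - ln (q x)"
    using pos ppos by eventually_elim (simp add: ln_div)
  have "integrable P (\<lambda>x. ln (p x / q x))"
    using eq int by (subst integrable_cong_AE[OF _ _ eq]) auto
  then have f_int: "integrable lborel ?f"
    unfolding p.Q_def using p.density_nonneg by (subst (asm) integrable_density) auto
  have "(\<integral>x. ln (p x) \<partial>P) - (\<integral>x. ln (q x) \<partial>P) = (\<integral>x. ln (p x) - ln (q x) \<partial>P)"
    using int by simp
  also have "\<dots> = (\<integral>x. ln (p x / q x) \<partial>P)"
    using eq by (intro integral_cong_AE) auto
  also have "\<dots> = (\<integral>x. ?f x \<partial>lborel)"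
    unfolding p.Q_def using p.density_nonneg by (subst integral_density) auto
  finally have D: "(\<integral>x. ln (p x) \<partial>P) - (\<integral>x. ln (q x) \<partial>P) = (\<integral>x. ?f x \<partial>lborel)" .
  have fin: "(\<integral>\<^sup>+x. ennreal (?f x) \<partial>lborel) \<noteq> \<infinity>" "(\<integral>\<^sup>+x. ennreal (- ?f x) \<partial>lborel) \<noteq> \<infinity>"
    using f_int by (auto simp: real_integrable_def)
  define a b where "a = enn2real (\<integral>\<^sup>+x. ennreal (?f x) \<partial>lborel)"
    and "b = enn2real (\<integral>\<^sup>+x. ennreal (- ?f x) \<partial>lborel)"
  then have ab: "(\<integral>\<^sup>+x. ennreal (?f x) \<partial>lborel) = ennreal a" "0 \<le> a"
      "(\<integral>\<^sup>+x. ennreal (- ?f x) \<partial>lborel) = ennreal b" "0 \<le> b"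
    using fin by (simp_all add: less_top)
  have "(\<integral>x. ?f x \<partial>lborel) = a - b"
    unfolding real_lebesgue_integral_def[OF f_int] ab using ab by simp
  then show ?thesis
    unfolding KL_density_def D using ac ab by (simp add: enn2ereal_ennreal)
qed

text \<open>Transfers from any independent family to the canonical model: \<open>i0\<close> names
  the query point and \<open>h\<close> enumerates the points among which neighbors are
  sought.\<close>

lemma distr_query_samples:
  assumes M: "prob_space M" and ind: "prob_space.indep_vars M (\<lambda>_. borel) Z I"
    and i0: "i0 \<in> I" and h: "inj h" "range h \<subseteq> I - {i0}"
    and law0: "distr M borel (Z i0) = P" and law: "\<And>j. distr M borel (Z (h j)) = Q"
  shows "(\<lambda>\<omega>. (Z i0 \<omega>, \<lambda>j. Z (h j) \<omega>)) \<in> measurable M query_samples"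
    and "distr M query_samples (\<lambda>\<omega>. (Z i0 \<omega>, \<lambda>j::nat. Z (h j) \<omega>)) = query_samples"
proof -
  interpret M: prob_space M by fact
  let ?B = "PiM UNIV (\<lambda>_::nat. borel :: 'a measure)"
  let ?Bi = "PiM {i0} (\<lambda>_. borel :: 'a measure)" and ?Bh = "PiM (range h) (\<lambda>_. borel :: 'a measure)"
  let ?Zi = "\<lambda>\<omega>. \<lambda>i\<in>{i0}. Z i \<omega>" and ?Zh = "\<lambda>\<omega>. \<lambda>i\<in>range h. Z i \<omega>"
  have rv: "Z i \<in> borel_measurable M" if "i \<in> I" for i
    using ind that by (auto simp: M.indep_vars_def2)
  have rv_h [measurable]: "Z (h j) \<in> borel_measurable M" for j using h(2) rv by blast
  have rv_0 [measurable]: "Z i0 \<in> borel_measurable M" using i0 rv by auto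
  \<comment> \<open>Reindexing by the injective \<open>h\<close>: singleton blocks of the family
    indexed by \<open>I\<close> become a sequence indexed by the naturals.\<close>
  have "M.indep_vars (\<lambda>j. PiM {h j} (\<lambda>_. borel)) (\<lambda>j \<omega>. \<lambda>i\<in>{h j}. Z i \<omega>) UNIV"
  proof (rule M.indep_vars_restrict[OF ind])
    show "{h j} \<subseteq> I" for j using h(2) by blast
    show "disjoint_family_on (\<lambda>j. {h j}) UNIV" using h(1) by (auto simp: disjoint_family_on_def inj_def)
  qed
  then have "M.indep_vars (\<lambda>_. borel) (\<lambda>j \<omega>. (\<lambda>i\<in>{h j}. Z i \<omega>) (h j)) UNIV"
    by (rule M.indep_vars_compose2[where Y="\<lambda>j f. f (h j)"]) (simp add: measurable_component_singleton)
  then have ind_h: "M.indep_vars (\<lambda>_. borel) (\<lambda>j. Z (h j)) UNIV" by simp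
  have "distr M ?B (\<lambda>\<omega>. \<lambda>j\<in>UNIV. Z (h j) \<omega>) = PiM UNIV (\<lambda>j. distr M borel (Z (h j)))"
    using M.indep_vars_iff_distr_eq_PiM[of UNIV "\<lambda>j. Z (h j)" "\<lambda>_. borel"] ind_h by auto
  then have law_h: "distr M ?B (\<lambda>\<omega> j. Z (h j) \<omega>) = samples" by (simp add: law restrict_def)
  \<comment> \<open>Independence of the query from the whole sequence, as two disjoint blocks of
    indices.\<close>
  have "M.indep_var ?Bi ?Zi ?Bh ?Zh"
    by (rule M.indep_var_restrict[OF ind]) (use h(2) i0 in auto)
  then have split: "distr M ?Bi ?Zi \<Otimes>\<^sub>M distr M ?Bh ?Zh = distr M (?Bi \<Otimes>\<^sub>M ?Bh) (\<lambda>\<omega>. (?Zi \<omega>, ?Zh \<omega>))"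
    by (simp add: M.indep_var_distribution_eq)
  have Z0 [measurable]: "?Zi \<in> measurable M ?Bi" and Zh [measurable]: "?Zh \<in> measurable M ?Bh"
    by (intro measurable_restrict; auto)+
  have T0 [measurable]: "(\<lambda>f. f i0) \<in> measurable ?Bi borel"
    by (rule measurable_component_singleton) simp
  have Th [measurable]: "(\<lambda>f j. f (h j)) \<in> measurable ?Bh ?B"
  proof (rule measurable_PiM_single')
    show "(\<lambda>f. f (h j)) \<in> measurable ?Bh borel" for j
      by (rule measurable_component_singleton) simp
  qed simp
  have "distr M borel (Z i0) \<Otimes>\<^sub>M distr M ?B (\<lambda>\<omega> j. Z (h j) \<omega>)
      = distr (distr M ?Bi ?Zi) borel (\<lambda>f. f i0) \<Otimes>\<^sub>M distr (distr M ?Bh ?Zh) ?B (\<lambda>f j. f (h j))"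
    by (simp add: distr_distr[OF T0 Z0] distr_distr[OF Th Zh] o_def)
  also have "\<dots> = distr (distr M ?Bi ?Zi \<Otimes>\<^sub>M distr M ?Bh ?Zh) (borel \<Otimes>\<^sub>M ?B) (\<lambda>(f, g). (f i0, \<lambda>j. g (h j)))"
  proof (rule pair_measure_distr)
    have "prob_space (distr (distr M ?Bh ?Zh) ?B (\<lambda>f j. f (h j)))"
      by (intro prob_space.prob_space_distr[OF M.prob_space_distr[OF Zh]]) (simp add: Th)
    then show "sigma_finite_measure (distr (distr M ?Bh ?Zh) ?B (\<lambda>f j. f (h j)))"
      by (simp add: prob_space_imp_sigma_finite)
  qed (simp_all add: T0 Th)
  also have "\<dots> = distr M (borel \<Otimes>\<^sub>M ?B) (\<lambda>\<omega>. (Z i0 \<omega>, \<lambda>j. Z (h j) \<omega>))"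
    unfolding split by (subst distr_distr) (auto simp: o_def)
  finally have "distr M borel (Z i0) \<Otimes>\<^sub>M distr M ?B (\<lambda>\<omega> j. Z (h j) \<omega>)
      = distr M (borel \<Otimes>\<^sub>M ?B) (\<lambda>\<omega>. (Z i0 \<omega>, \<lambda>j. Z (h j) \<omega>))" .
  then have eq: "distr M (borel \<Otimes>\<^sub>M ?B) (\<lambda>\<omega>. (Z i0 \<omega>, \<lambda>j. Z (h j) \<omega>)) = query_samples"
    by (simp add: law0 law_h)
  \<comment> \<open>An image measure depends on its target only through the measurable sets, so
    \<open>borel\<close> may be exchanged for \<open>P\<close> and \<open>Q\<close>.\<close>
  have sets_eq: "sets query_samples = sets (borel \<Otimes>\<^sub>M ?B)"
    by (intro sets_pair_measure_cong sets_PiM_cong) auto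
  show "distr M query_samples (\<lambda>\<omega>. (Z i0 \<omega>, \<lambda>j. Z (h j) \<omega>)) = query_samples"
    using eq distr_cong[OF refl sets_eq refl] by metis
  have "(\<lambda>\<omega>. (Z i0 \<omega>, \<lambda>j. Z (h j) \<omega>)) \<in> measurable M (borel \<Otimes>\<^sub>M ?B)"
  proof (rule measurable_Pair)
    show "(\<lambda>\<omega> j. Z (h j) \<omega>) \<in> measurable M ?B"
      by (rule measurable_PiM_single'[OF rv_h]) simp
  qed (rule rv_0)
  then show "(\<lambda>\<omega>. (Z i0 \<omega>, \<lambda>j. Z (h j) \<omega>)) \<in> measurable M query_samples"
    using measurable_cong_sets[OF refl sets_eq] by blast
qed

end

context regular_density_pair
begin

lemma sample_mean_ln_dist:
  assumes M: "prob_space M" and ind: "prob_space.indep_vars M (\<lambda>_. borel) Z I"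
    and i0: "i0 \<in> I" and h: "inj h" "range h \<subseteq> I - {i0}"
    and law0: "distr M borel (Z i0) = P" and law: "\<And>j::nat. distr M borel (Z (h j)) = Q"
    and lm: "1 \<le> l" "l \<le> m"
  shows "(\<lambda>\<omega>. nn_dist l (Z i0 \<omega>) (\<lambda>j. Z (h j) \<omega>) {..<m}) \<in> borel_measurable M"
    and "AE \<omega> in M. 0 < nn_dist l (Z i0 \<omega>) (\<lambda>j. Z (h j) \<omega>) {..<m}"
    and "has_bochner_integral M
      (\<lambda>\<omega>. ln (real m * nn_dist l (Z i0 \<omega>) (\<lambda>j. Z (h j) \<omega>) {..<m} ^ DIM('a))) (mean_ln_dist l m)"
proof -
  note meas = distr_query_samples(1)[OF M ind i0 h law0 law]
    and distr = distr_query_samples(2)[OF M ind i0 h law0 law]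
  show "(\<lambda>\<omega>. nn_dist l (Z i0 \<omega>) (\<lambda>j. Z (h j) \<omega>) {..<m}) \<in> borel_measurable M"
    using measurable_compose[OF meas measurable_nn_dist_query[OF lm]] by simp
  have "AE z in distr M query_samples (\<lambda>\<omega>. (Z i0 \<omega>, \<lambda>j. Z (h j) \<omega>)). 0 < nn_dist l (fst z) (snd z) {..<m}"
    using AE_query_nn_dist_pos[OF lm] by (simp only: distr)
  from AE_distrD[OF meas this]
  show "AE \<omega> in M. 0 < nn_dist l (Z i0 \<omega>) (\<lambda>j. Z (h j) \<omega>) {..<m}" by simp
  let ?f = "\<lambda>z. ln (real m * nn_dist l (fst z) (snd z) {..<m} ^ DIM('a))"
  have f: "?f \<in> borel_measurable query_samples" using mean_ln_dist_eq(1)[OF lm] by auto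
  show "has_bochner_integral M
      (\<lambda>\<omega>. ln (real m * nn_dist l (Z i0 \<omega>) (\<lambda>j. Z (h j) \<omega>) {..<m} ^ DIM('a))) (mean_ln_dist l m)"
    using integrable_distr_eq[OF meas f] integral_distr[OF meas f] mean_ln_dist_eq(1)[OF lm]
    unfolding distr mean_ln_dist_def has_bochner_integral_iff by simp
qed

end

section \<open>From the hypotheses and the indexing of the theorem to the canonical model\<close>

lemma regular_density_pairI:
  assumes "prob_density p" "prob_density q" and pos: "0 < \<epsilon>1" "0 < \<epsilon>2" "0 < R1" "0 < R2" "1 \<le> N"
    and fin: "K_fun p q 1 N < \<infinity>" "Q_fun p q \<epsilon>1 R1 < \<infinity>" "T_fun p q \<epsilon>2 R2 < \<infinity>"
  shows "regular_density_pair q p (min R1 R2)"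
proof -
  interpret density_pair q p
    using assms(1,2) by (simp add: density_pair_def)
  show ?thesis
  proof
    show "0 < min R1 R2" using pos by simp
    show "(\<integral>\<^sup>+x. sup_ln (min R1 R2) x \<partial>P) < \<infinity>"
      using fin pos by (intro nn_integral_sup_ln_finite[of \<epsilon>1 R1]) auto
    show "(\<integral>\<^sup>+x. sup_neg_ln (min R1 R2) x \<partial>P) < \<infinity>"
      using fin pos by (intro nn_integral_sup_neg_ln_finite[of \<epsilon>2 R2]) auto
    show "(\<integral>\<^sup>+x. (\<integral>\<^sup>+y. ennreal (ln (max 1 (norm (x - y)))) \<partial>Q) \<partial>P) < \<infinity>"
      using fin pos by (intro nn_integral_ln_dist_finite) auto
  qed
qed

lemma prob_density_if_distributed:
  assumes "prob_space M" "\<And>x. 0 \<le> p x" "distributed M lborel X (\<lambda>x. ennreal (p x))"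
  shows "prob_density p" and "distr M borel X = density lborel (\<lambda>x. ennreal (p x))"
proof -
  interpret M: prob_space M by fact
  have d: "distr M lborel X = density lborel (\<lambda>x. ennreal (p x))"
    "(\<lambda>x. ennreal (p x)) \<in> borel_measurable borel" "X \<in> measurable M lborel"
    using assms(3) by (auto simp: distributed_def)
  \<comment> \<open>Measurability is given for the extended density; nonnegativity of
    \<open>p\<close> allows going back to the real one.\<close>
  have "(\<lambda>x. enn2real (ennreal (p x))) \<in> borel_measurable borel" using d(2) by measurable
  then have "p \<in> borel_measurable borel" using assms(2) by simp
  moreover have "prob_space (density lborel (\<lambda>x. ennreal (p x)))"
    unfolding d(1)[symmetric] using d(3) by (rule M.prob_space_distr)
  ultimately show "prob_density p" using assms(2) by (simp add: prob_density_def)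
  have "distr M borel X = distr M lborel X" by (rule distr_cong) simp_all
  then show "distr M borel X = density lborel (\<lambda>x. ennreal (p x))" by (rule trans[OF _ d(1)])
qed

lemma V_dist_eq:
  assumes "1 \<le> l" "l \<le> m"
  shows "V_dist m l x y i = nn_dist l (x i) (\<lambda>j. y (Suc j)) {..<m}"
proof -
  have "bij_betw Suc {..<m} {1..m}"
    by (auto simp: bij_betw_def image_Suc_lessThan)
  from nn_dist_reindex[OF this, of l "x i" y] show ?thesis
    using assms by (simp add: V_dist_def nn_dist_def)
qed

text \<open>Enumerates \<open>{1..} - {i}\<close> in increasing order, starting from index \<open>0\<close>.\<close>

definition skip :: "nat \<Rightarrow> nat \<Rightarrow> nat" where
  "skip i j = (if Suc j < i then Suc j else Suc (Suc j))"

lemma inj_skip: "inj (skip i)" and skip_neq: "skip i j \<noteq> i" and skip_ge_1: "1 \<le> skip i j"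
  by (auto simp: inj_def skip_def split: if_splits)

text \<open>The sample without \<open>i\<close> has \<open>n - 1\<close> points, which explains the
  factor \<open>n - 1\<close> in the estimator.\<close>

lemma R_dist_eq:
  assumes "1 \<le> k" "Suc k \<le> n" "i \<in> {1..n}"
  shows "R_dist n k x i = nn_dist k (x i) (\<lambda>j. x (skip i j)) {..<n - 1}"
proof -
  have "skip i ` {..<n - 1} = {1..n} - {i}"
  proof (intro equalityI subsetI)
    fix t assume t: "t \<in> {1..n} - {i}"
    show "t \<in> skip i ` {..<n - 1}"
    proof (cases "t < i")
      case True
      then have "t = skip i (t - 1)" "t - 1 < n - 1" using t assms by (auto simp: skip_def)
      then show ?thesis by blast
    next
      case False
      then have "t = skip i (t - 2)" "t - 2 < n - 1" using t assms by (auto simp: skip_def)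
      then show ?thesis by blast
    qed
  qed (use assms in \<open>auto simp: skip_def split: if_splits\<close>)
  then have "bij_betw (skip i) {..<n - 1} ({1..n} - {i})"
    using inj_skip by (auto simp: bij_betw_def intro: inj_on_subset)
  from nn_dist_reindex[OF this, of k "x i" x] show ?thesis
    using assms by (simp add: R_dist_def nn_dist_def)
qed

theorem theorem1:
  fixes M :: "'w measure"
    and X Y :: "'w \<Rightarrow> 'a::euclidean_space"
    and Xs Ys :: "nat \<Rightarrow> 'w \<Rightarrow> 'a"
    and p q :: "'a \<Rightarrow> real"
    and \<epsilon>1 \<epsilon>2 \<epsilon>3 \<epsilon>4 R1 R2 R3 R4 :: real
    and N1 N2 k l :: nat
  assumes "prob_space M"
    and "\<And>x. p x \<ge> 0" and "\<And>x. q x \<ge> 0"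
    and "distributed M lborel X (\<lambda>x. ennreal (p x))"
    and "distributed M lborel Y (\<lambda>x. ennreal (q x))"
    and "\<And>i. i \<ge> 1 \<Longrightarrow> distr M borel (Xs i) = distr M borel X"
    and "\<And>i. i \<ge> 1 \<Longrightarrow> distr M borel (Ys i) = distr M borel Y"
    and "prob_space.indep_vars M (\<lambda>_. borel) (case_sum Xs Ys) ({1..} <+> {1..})"
    and "\<epsilon>1 > 0" and "\<epsilon>2 > 0" and "\<epsilon>3 > 0" and "\<epsilon>4 > 0"
    and "R1 > 0" and "R2 > 0" and "R3 > 0" and "R4 > 0"
    and "N1 \<ge> 1" and "N2 \<ge> 1"
    and "K_fun p q 1 N1 < \<infinity>" and "Q_fun p q \<epsilon>1 R1 < \<infinity>" and "T_fun p q \<epsilon>2 R2 < \<infinity>"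
    and "K_fun p p 1 N2 < \<infinity>" and "Q_fun p p \<epsilon>3 R3 < \<infinity>" and "T_fun p p \<epsilon>4 R4 < \<infinity>"
    and "k \<ge> 1" and "l \<ge> 1"
  shows "(\<forall>\<^sub>F (n, m) in sequentially \<times>\<^sub>F sequentially.
            integrable M (\<lambda>\<omega>. KL_estimate n m k l (\<lambda>i. Xs i \<omega>) (\<lambda>i. Ys i \<omega>)))
       \<and> ((\<lambda>(n, m). ereal (integral\<^sup>L M (\<lambda>\<omega>. KL_estimate n m k l (\<lambda>i. Xs i \<omega>) (\<lambda>i. Ys i \<omega>))))
            \<longlongrightarrow> KL_density p q) (sequentially \<times>\<^sub>F sequentially)"
proof -
  interpret M: prob_space M by fact
  note p = prob_density_if_distributed[OF assms(1,2,4)]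
  note q = prob_density_if_distributed[OF assms(1,3,5)]
  interpret pq: regular_density_pair q p "min R1 R2"
    using assms p q by (intro regular_density_pairI[of p q \<epsilon>1 \<epsilon>2 R1 R2 N1]) auto
  interpret pp: regular_density_pair p p "min R3 R4"
    using assms p by (intro regular_density_pairI[of p p \<epsilon>3 \<epsilon>4 R3 R4 N2]) auto
  have law_X: "distr M borel (Xs i) = pq.P" if "1 \<le> i" for i
    using assms(6)[OF that] p(2) by (simp add: pq.p.Q_def)
  have law_Y: "distr M borel (Ys i) = pq.Q" if "1 \<le> i" for i
    using assms(7)[OF that] q(2) by (simp add: pq.Q_def)
  let ?v = "pq.mean_ln_dist l" and ?r = "pp.mean_ln_dist k"
  let ?E = "\<lambda>n m \<omega>. KL_estimate n m k l (\<lambda>i. Xs i \<omega>) (\<lambda>i. Ys i \<omega>)"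
  \<comment> \<open>Every summand has mean \<open>?v m - ?r (n - 1)\<close>, whatever the dependence
    between summands, so the average over \<open>i\<close> has this mean too.\<close>
  have estimate: "has_bochner_integral M (?E n m) (Digamma (real k) - Digamma (real l) + (?v m - ?r (n - 1)))"
    if nm: "Suc k \<le> n" "l \<le> m" for n m
  proof -
    let ?V = "\<lambda>i \<omega>. V_dist m l (\<lambda>i. Xs i \<omega>) (\<lambda>i. Ys i \<omega>) i"
    let ?R = "\<lambda>i \<omega>. R_dist n k (\<lambda>i. Xs i \<omega>) i"
    let ?t = "\<lambda>i \<omega>. ln ((real m * ?V i \<omega> ^ DIM('a)) / ((real n - 1) * ?R i \<omega> ^ DIM('a)))"
    have n1: "real (n - 1) = real n - 1" "1 < n" using nm assms by (auto simp: of_nat_diff)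
    have "has_bochner_integral M (?t i) (?v m - ?r (n - 1))" if i: "i \<in> {1..n}" for i
    proof -
      have V_eq: "?V i \<omega> = nn_dist l (case_sum Xs Ys (Inl i) \<omega>) (\<lambda>j. case_sum Xs Ys (Inr (Suc j)) \<omega>) {..<m}" for \<omega>
        using nm assms by (simp add: V_dist_eq)
      have R_eq: "?R i \<omega> = nn_dist k (case_sum Xs Ys (Inl i) \<omega>) (\<lambda>j. case_sum Xs Ys (Inl (skip i j)) \<omega>) {..<n - 1}" for \<omega>
        using nm assms i by (simp add: R_dist_eq)
      have i0: "Inl i \<in> {1..} <+> {1..}" using i by auto
      have hV: "inj (\<lambda>j. Inr (Suc j) :: nat + nat)" "range (\<lambda>j. Inr (Suc j)) \<subseteq> ({1..} <+> {1..}) - {Inl i}"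
        by (auto simp: inj_def)
      have hR: "inj (\<lambda>j. Inl (skip i j) :: nat + nat)" "range (\<lambda>j. Inl (skip i j)) \<subseteq> ({1..} <+> {1..}) - {Inl i}"
        using inj_skip[of i] skip_neq[of i] skip_ge_1[of i] by (auto simp: inj_def)
      have law: "distr M borel (case_sum Xs Ys (Inl i)) = pq.P"
        "distr M borel (case_sum Xs Ys (Inr (Suc j))) = pq.Q"
        "distr M borel (case_sum Xs Ys (Inl (skip i j))) = pq.P" for j
        using i skip_ge_1[of i j] by (simp_all add: law_X law_Y)
      have km: "k \<le> n - 1" using nm by simp
      \<comment> \<open>The same query index \<open>Inl i\<close> with two enumerations: all points
        of the second sample for \<open>V\<close>, the other points of the first for
        \<open>R\<close>.\<close>
      note V = pq.sample_mean_ln_dist[OF assms(1,8) i0 hV law(1,2) assms(26) nm(2), folded V_eq]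
      note R = pp.sample_mean_ln_dist[OF assms(1,8) i0 hR law(1,3) assms(25) km, folded R_eq]
      have "has_bochner_integral M
          (\<lambda>\<omega>. ln (real m * ?V i \<omega> ^ DIM('a)) - ln (real (n - 1) * ?R i \<omega> ^ DIM('a))) (?v m - ?r (n - 1))"
        using V(3) R(3) by (rule has_bochner_integral_diff)
      \<comment> \<open>The logarithm of the quotient splits only where both distances are positive,
        which holds almost surely.\<close>
      moreover have "AE \<omega> in M. ?t i \<omega> = ln (real m * ?V i \<omega> ^ DIM('a)) - ln (real (n - 1) * ?R i \<omega> ^ DIM('a))"
        using V(2) R(2)
      proof eventually_elim
        fix \<omega> assume "0 < ?V i \<omega>" "0 < ?R i \<omega>"
        then show "?t i \<omega> = ln (real m * ?V i \<omega> ^ DIM('a)) - ln (real (n - 1) * ?R i \<omega> ^ DIM('a))"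
          using n1 nm assms(26) by (subst ln_div) auto
      qed
      moreover have "?t i \<in> borel_measurable M"
        using V(1) R(1) by measurable
      moreover have "(\<lambda>\<omega>. ln (real m * ?V i \<omega> ^ DIM('a)) - ln (real (n - 1) * ?R i \<omega> ^ DIM('a))) \<in> borel_measurable M"
        using V(1) R(1) by measurable
      ultimately show ?thesis by (subst has_bochner_integral_cong_AE)
    qed
    then have "has_bochner_integral M (\<lambda>\<omega>. (\<Sum>i=1..n. ?t i \<omega>)) (\<Sum>i=1..n. ?v m - ?r (n - 1))"
      by (rule has_bochner_integral_sum)
    then have "has_bochner_integral M (\<lambda>\<omega>. (1 / real n) * (\<Sum>i=1..n. ?t i \<omega>)) ((1 / real n) * (\<Sum>i=1..n. ?v m - ?r (n - 1)))"
      by (intro has_bochner_integral_mult_right)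
    moreover have "has_bochner_integral M (\<lambda>\<omega>. Digamma (real k) - Digamma (real l)) (Digamma (real k) - Digamma (real l))"
      by (simp add: has_bochner_integral_iff M.prob_space)
    ultimately have "has_bochner_integral M (?E n m)
        (Digamma (real k) - Digamma (real l) + (1 / real n) * (\<Sum>i=1..n. ?v m - ?r (n - 1)))"
      unfolding KL_estimate_def by (intro has_bochner_integral_add)
    then show ?thesis using n1 by simp
  qed
  have ev: "\<forall>\<^sub>F z in sequentially \<times>\<^sub>F sequentially. Suc k \<le> fst z \<and> l \<le> snd z"
    by (intro eventually_prodI eventually_ge_at_top)
  \<comment> \<open>The mean is a function of \<open>m\<close> minus a function of \<open>n\<close>,
    so each limit is taken along one projection of the product filter.\<close>
  have "((\<lambda>z. ereal (Digamma (real k) - Digamma (real l) + (?v (snd z) - ?r (fst z - 1)))) \<longlongrightarrow>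
      ereal (Digamma (real k) - Digamma (real l) +
        ((Digamma (real l) - ln (unit_ball_vol (real DIM('a))) - (\<integral>x. ln (q x) \<partial>pq.P))
         - (Digamma (real k) - ln (unit_ball_vol (real DIM('a))) - (\<integral>x. ln (p x) \<partial>pp.P)))))
      (sequentially \<times>\<^sub>F sequentially)"
  proof (intro tendsto_ereal tendsto_intros)
    show "((\<lambda>z. ?v (snd z)) \<longlongrightarrow>
        Digamma (real l) - ln (unit_ball_vol (real DIM('a))) - (\<integral>x. ln (q x) \<partial>pq.P))
      (sequentially \<times>\<^sub>F sequentially)"
      by (rule filterlim_compose[OF pq.mean_ln_dist_tendsto[OF assms(26)] filterlim_snd])
    have "(\<lambda>n. ?r (n - 1)) \<longlonglongrightarrow>
        Digamma (real k) - ln (unit_ball_vol (real DIM('a))) - (\<integral>x. ln (p x) \<partial>pp.P)"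
      by (rule filterlim_compose[OF pp.mean_ln_dist_tendsto[OF assms(25)] filterlim_minus_const_nat_at_top])
    then show "((\<lambda>z. ?r (fst z - 1)) \<longlongrightarrow>
        Digamma (real k) - ln (unit_ball_vol (real DIM('a))) - (\<integral>x. ln (p x) \<partial>pp.P))
      (sequentially \<times>\<^sub>F sequentially)"
      by (rule filterlim_compose[OF _ filterlim_fst])
  qed
  \<comment> \<open>Digamma values and volume constants cancel, leaving the mean of
    \<open>ln p\<close> minus that of \<open>ln q\<close>.\<close>
  also have "ereal (Digamma (real k) - Digamma (real l) +
        ((Digamma (real l) - ln (unit_ball_vol (real DIM('a))) - (\<integral>x. ln (q x) \<partial>pq.P))
         - (Digamma (real k) - ln (unit_ball_vol (real DIM('a))) - (\<integral>x. ln (p x) \<partial>pp.P)))) = KL_density p q"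
    by (subst pq.KL_density_eq)
       (use pq.AE_density_pos pq.ln_ratio_convergence(1)[OF assms(26)] pp.ln_ratio_convergence(1)[OF assms(25)] in auto)
  finally have lim: "((\<lambda>z. ereal (Digamma (real k) - Digamma (real l) + (?v (snd z) - ?r (fst z - 1)))) \<longlongrightarrow>
      KL_density p q) (sequentially \<times>\<^sub>F sequentially)" .
  show ?thesis
  proof
    show "\<forall>\<^sub>F (n, m) in sequentially \<times>\<^sub>F sequentially. integrable M (?E n m)"
      using ev by eventually_elim (auto intro!: integrable.intros[OF estimate])
    show "((\<lambda>(n, m). ereal (integral\<^sup>L M (?E n m))) \<longlongrightarrow> KL_density p q) (sequentially \<times>\<^sub>F sequentially)"
      using lim
    proof (rule Lim_transform_eventually)
      show "\<forall>\<^sub>F z in sequentially \<times>\<^sub>F sequentially.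
          ereal (Digamma (real k) - Digamma (real l) + (?v (snd z) - ?r (fst z - 1))) =
          (case z of (n, m) \<Rightarrow> ereal (integral\<^sup>L M (?E n m)))"
        using ev by eventually_elim (simp add: split_beta has_bochner_integral_integral_eq[OF estimate])
    qed
  qed
qed

end
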